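(* Let $p > 911$ be a prime. If $x, y \in \mathbb{Z}$ satisfy $x^2 - 2 = y^p$, then $y = -1$. *)

theory Defs
  imports "HOL-Computational_Algebra.Primes"
begin

end

theory Submission
  imports Defs "HOL-Analysis.Harmonic_Numbers" "Jordan_Normal_Form.Determinant"
begin

text \<open>
  Write \<open>\<epsilon> = 1 + \<surd>2\<close>. Reduction modulo 8 gives \<open>y \<ge> 7\<close> unless \<open>y = -1\<close>. Unique factorization in \<open>\<int>[\<surd>2]\<close>
  yields \<open>x + \<surd>2 = \<epsilon>\<^sup>r \<alpha>\<^sup>p\<close> with \<open>2 \<bar>r\<bar> < p\<close> and \<open>\<bar>N \<alpha>\<bar> = y\<close>. With \<open>g = \<alpha>\<^sup>2 / y\<close>, whose conjugate is \<open>1 / g\<close>,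
  the linear form \<open>\<Lambda> = 2 r ln \<epsilon> + p ln g = ln ((x + \<surd>2) / (x - \<surd>2))\<close> satisfies \<open>\<bar>\<Lambda>\<bar> y\<^bsup>p/2\<^esup> \<le> 4\<close>.

  This is refuted by an interpolation determinant in the style of Laurent. Its entries are
  \<open>binom(z, k) v\<^sup>l\<close> with \<open>k < K\<close>, \<open>\<bar>l\<bar> \<le> h\<close>, where a node is a pair of integers \<open>(a, s)\<close>, \<open>z = a p - s r\<close> and
  \<open>v = \<epsilon>\<^bsup>2a\<^esup> g\<^sup>s\<close>, so that \<open>ln v\<close> is proportional to \<open>z\<close> up to a multiple of \<open>\<Lambda>\<close>. Three ideas make
  the estimates strong enough for all \<open>r\<close> and all \<open>p > 911\<close> at once. The nodes fill the parallelogram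
  \<open>\<bar>s\<bar> \<le> \<sigma>\<close>, \<open>2 \<bar>z\<bar> \<le> (m + 1) p\<close>, so the size of \<open>ln g\<close> plays no role. Conjugation maps \<open>v\<^sup>l\<close> to \<open>v\<^sup>-\<^sup>l\<close> and
  thus only permutes the columns, so the square of the determinant is rational, which halves the
  arithmetic cost. Finally the nodes are real, so expanding the entries in Chebyshev polynomials
  instead of powers replaces the radius \<open>\<rho>\<close> in the analytic upper bound by \<open>(\<rho> + 1/\<rho>) / 2\<close>; here \<open>\<rho> = 16\<close>.
\<close>

section \<open>Determinants of functions with small Chebyshev expansions\<close>

text \<open>The points of \<open>D\<close> are parametrised by angles, so \<open>cos (n \<theta>)\<close> is the \<open>n\<close>-th Chebyshev polynomial. Everything
  beyond the first \<open>N\<close> terms is collected in \<open>e\<close> and weighted like the term of index \<open>N\<close>.\<close>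

definition cheb_norm_le :: "'a set \<Rightarrow> ('a \<Rightarrow> real) \<Rightarrow> nat \<Rightarrow> real \<Rightarrow> ('a \<Rightarrow> real) \<Rightarrow> real \<Rightarrow> bool" where
  "cheb_norm_le D \<theta> N \<eta> f F \<longleftrightarrow> (\<exists>c e B. 0 \<le> B \<and>
     (\<forall>t\<in>D. f t = (\<Sum>n<N. c n * cos (real n * \<theta> t)) + e t \<and> \<bar>e t\<bar> \<le> B) \<and>
     (\<Sum>n<N. \<bar>c n\<bar> * cosh (real n * \<eta>)) + B * cosh (real N * \<eta>) \<le> F)"

text \<open>The index \<open>N\<close> stands for the remainder and may repeat; its deficit
  \<open>N - \<nu> j\<close> is 0. The indices below \<open>N\<close> are distinct, so all deficits
  together are at most 1 + ... + N.\<close>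

lemma sum_ge_if_inj_below:
  fixes \<nu> :: "nat \<Rightarrow> nat"
  assumes "\<And>j. j < N \<Longrightarrow> \<nu> j \<le> N" and inj: "inj_on \<nu> {j. j < N \<and> \<nu> j < N}"
  shows "N * (N - 1) div 2 \<le> (\<Sum>j<N. \<nu> j)"
proof -
  let ?S = "{j. j < N \<and> \<nu> j < N}"
  have "(\<Sum>j<N. N - \<nu> j) = (\<Sum>j\<in>?S. N - \<nu> j)"
    by (intro sum.mono_neutral_right) auto
  also have "\<dots> = (\<Sum>n\<in>\<nu> ` ?S. N - n)"
    using inj by (simp add: sum.reindex)
  also have "\<dots> \<le> (\<Sum>n<N. N - n)"
    by (rule sum_mono2) auto
  finally have 1: "(\<Sum>j<N. N - \<nu> j) \<le> (\<Sum>n<N. N - n)" .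
  have "(\<Sum>j<N. N - \<nu> j) + (\<Sum>j<N. \<nu> j) = (\<Sum>j<N. N)"
    unfolding sum.distrib[symmetric] using assms(1) by (intro sum.cong) auto
  moreover have "(\<Sum>n<N. N - n) + (\<Sum>n<N. n) = (\<Sum>j<N. N)"
    unfolding sum.distrib[symmetric] by (intro sum.cong) auto
  moreover have "(\<Sum>n<N. n) = N * (N - 1) div 2"
    using Sum_Ico_nat[of 0 N] by (simp add: atLeast0LessThan)
  ultimately show ?thesis using 1 by linarith
qed

lemma det_mat_Leibniz:
  "det (mat N N (\<lambda>(j,i). g j i)) = (\<Sum>p | p permutes {..<N}. signof p * (\<Prod>j<N. g j (p j)))"
proof -
  have "(\<Prod>j = 0..<N. mat N N (\<lambda>(j,i). g j i) $$ (j, p j)) = (\<Prod>j<N. g j (p j))"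
    if "p permutes {0..<N}" for p
  proof -
    have "p j < N" if "j < N" for j
      using permutes_in_image[OF \<open>p permutes {0..<N}\<close>, of j] that by auto
    then show ?thesis
      unfolding atLeast0LessThan by (intro prod.cong) auto
  qed
  then show ?thesis
    by (subst det_def'[of _ N]) (auto intro!: sum.cong simp: atLeast0LessThan)
qed

lemma abs_signof [simp]: "\<bar>signof p\<bar> = (1::real)"
  by (simp add: sign_def)

text \<open>Expand every row. A selection of terms contributes only if the chosen indices below \<open>N\<close> are
  distinct, and then they sum to at least \<open>N (N - 1) / 2\<close>.\<close>

lemma abs_det_le_cheb:
  fixes f :: "nat \<Rightarrow> nat \<Rightarrow> real"
  assumes "\<And>i. i < N \<Longrightarrow> cheb_norm_le {..<N} \<theta> N \<eta> (f i) (F i)" and "0 \<le> \<eta>"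
  shows "\<bar>det (mat N N (\<lambda>(j,i). f i j))\<bar> \<le>
           fact N * 2 ^ N * exp (- \<eta> * real (N * (N - 1) div 2)) * (\<Prod>i<N. F i)"
proof -
  define E where "E = N * (N - 1) div 2"
  define Q where "Q i = (\<lambda>(c, e, B). 0 \<le> B \<and>
     (\<forall>t\<in>{..<N}. f i t = (\<Sum>n<N. c n * cos (real n * \<theta> t)) + e t \<and> \<bar>e t\<bar> \<le> B) \<and>
     (\<Sum>n<N. \<bar>c n\<bar> * cosh (real n * \<eta>)) + B * cosh (real N * \<eta>) \<le> F i)" for i
  have "\<exists>q. i < N \<longrightarrow> Q i q" for i
    using assms(1)[of i] unfolding cheb_norm_le_def Q_def by auto
  then obtain q where q: "\<And>i. i < N \<longrightarrow> Q i (q i)"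
    using choice[of "\<lambda>i q. i < N \<longrightarrow> Q i q"] by auto
  define c where "c i = fst (q i)" for i
  define e where "e i = fst (snd (q i))" for i
  define B where "B i = snd (snd (q i))" for i
  have ceB: "0 \<le> B i \<and>
     (\<forall>t<N. f i t = (\<Sum>n<N. c i n * cos (real n * \<theta> t)) + e i t \<and> \<bar>e i t\<bar> \<le> B i) \<and>
     (\<Sum>n<N. \<bar>c i n\<bar> * cosh (real n * \<eta>)) + B i * cosh (real N * \<eta>) \<le> F i" if "i < N" for i
    using q[of i] that unfolding Q_def c_def e_def B_def by (auto simp: case_prod_beta)
  \<comment> \<open>Index \<open>N\<close> carries the remainder, so every entry becomes a sum over
    \<open>n \<le> N\<close>. Below \<open>N\<close> the coefficient depends on the column
    \<open>i\<close> only, not on the row \<open>j\<close>; this makes repeated indices cancel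
    later.\<close>
  define C where "C i j n = (if n < N then c i n else e i j)" for i j n
  define a where "a j n = (if n < N then cos (real n * \<theta> j) else 1)" for j n
  \<comment> \<open>The weights use \<open>exp\<close> in place of \<open>cosh\<close>. Since
    \<open>exp t \<le> 2 * cosh t\<close>, they sum to at most \<open>2 * F i\<close>, which is the
    origin of the factor \<open>2 ^ N\<close>.\<close>
  define W where "W i n = (if n < N then \<bar>c i n\<bar> else B i) * exp (real n * \<eta>)" for i n
  have f_eq: "f i j = (\<Sum>n\<le>N. a j n * C i j n)" if "i < N" "j < N" for i j
    using ceB[OF that(1)] that(2)
    by (simp add: lessThan_Suc_atMost[symmetric] C_def a_def mult.commute)
  have W_nn: "0 \<le> W i n" if "i < N" for i n
    using ceB[OF that] by (simp add: W_def)
  have W_sum: "(\<Sum>n\<le>N. W i n) \<le> 2 * F i" if "i < N" for i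
  proof -
    have "(\<Sum>n\<le>N. W i n) = (\<Sum>n<N. \<bar>c i n\<bar> * exp (real n * \<eta>)) + B i * exp (real N * \<eta>)"
      by (simp add: lessThan_Suc_atMost[symmetric] W_def)
    also have "\<dots> \<le> (\<Sum>n<N. \<bar>c i n\<bar> * (2 * cosh (real n * \<eta>))) + B i * (2 * cosh (real N * \<eta>))"
      using ceB[OF that] by (intro add_mono sum_mono mult_left_mono) (auto simp: cosh_def)
    also have "\<dots> = 2 * ((\<Sum>n<N. \<bar>c i n\<bar> * cosh (real n * \<eta>)) + B i * cosh (real N * \<eta>))"
      by (simp add: sum_distrib_left algebra_simps)
    also have "\<dots> \<le> 2 * F i" using ceB[OF that] by (intro mult_left_mono) auto
    finally show ?thesis .
  qed
  have G_le: "\<bar>a j n * C i j n\<bar> \<le> W i n * exp (- \<eta> * real n)" if "i < N" "j < N" "n \<le> N" for i j n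
  proof -
    have "\<bar>a j n\<bar> * \<bar>C i j n\<bar> \<le> 1 * (if n < N then \<bar>c i n\<bar> else B i)"
      using ceB[OF that(1)] that by (intro mult_mono) (auto simp: a_def C_def)
    moreover have "W i n * exp (- \<eta> * real n) = (if n < N then \<bar>c i n\<bar> else B i)"
      by (simp add: W_def mult.assoc exp_add[symmetric])
    ultimately show ?thesis by (simp add: abs_mult)
  qed
  let ?P = "{p. p permutes {..<N}}"
  let ?V = "{..<N} \<rightarrow>\<^sub>E {..N}"
  have fin: "finite ?P" "finite ?V" by (auto intro: finite_permutations finite_PiE)
  have perm_lt: "p j < N" if "p \<in> ?P" "j < N" for p j
    using permutes_in_image[of p "{..<N}" j] that by auto
  \<comment> \<open>\<open>\<nu> j\<close> is the term selected in row \<open>j\<close>;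
    \<open>T \<nu>\<close> is the share of that selection in the determinant.\<close>
  define T where "T \<nu> = (\<Sum>p\<in>?P. signof p * (\<Prod>j<N. a j (\<nu> j) * C (p j) j (\<nu> j)))" for \<nu>
  have "det (mat N N (\<lambda>(j,i). f i j)) = (\<Sum>p\<in>?P. signof p * (\<Prod>j<N. f (p j) j))"
    by (rule det_mat_Leibniz)
  also have "\<dots> = (\<Sum>p\<in>?P. signof p * (\<Sum>\<nu>\<in>?V. \<Prod>j<N. a j (\<nu> j) * C (p j) j (\<nu> j)))"
  proof (intro sum.cong refl arg_cong2[of _ _ _ _ "(*)"])
    fix p assume p: "p \<in> ?P"
    have "(\<Prod>j<N. f (p j) j) = (\<Prod>j<N. \<Sum>n\<le>N. a j n * C (p j) j n)"
      using perm_lt[OF p] by (intro prod.cong) (auto simp: f_eq)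
    also have "\<dots> = (\<Sum>\<nu>\<in>?V. \<Prod>j<N. a j (\<nu> j) * C (p j) j (\<nu> j))"
      by (rule prod_sum_PiE) auto
    finally show "(\<Prod>j<N. f (p j) j) = (\<Sum>\<nu>\<in>?V. \<Prod>j<N. a j (\<nu> j) * C (p j) j (\<nu> j))" .
  qed
  also have "\<dots> = (\<Sum>\<nu>\<in>?V. T \<nu>)"
    unfolding T_def sum_distrib_left by (rule sum.swap)
  finally have det_eq: "det (mat N N (\<lambda>(j,i). f i j)) = (\<Sum>\<nu>\<in>?V. T \<nu>)" .
  have T_le: "\<bar>T \<nu>\<bar> \<le> exp (- \<eta> * real E) * (\<Sum>p\<in>?P. \<Prod>j<N. W (p j) (\<nu> j))" if \<nu>: "\<nu> \<in> ?V" for \<nu>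
  proof (cases "inj_on \<nu> {j. j < N \<and> \<nu> j < N}")
    case True
    have \<nu>_le: "\<nu> j \<le> N" if "j < N" for j using \<nu> that by auto
    have E_le: "E \<le> (\<Sum>j<N. \<nu> j)"
      unfolding E_def using \<nu>_le True by (rule sum_ge_if_inj_below)
    have "\<bar>T \<nu>\<bar> \<le> (\<Sum>p\<in>?P. \<bar>signof p * (\<Prod>j<N. a j (\<nu> j) * C (p j) j (\<nu> j))\<bar>)"
      unfolding T_def by (rule sum_abs)
    also have "\<dots> \<le> (\<Sum>p\<in>?P. exp (- \<eta> * real E) * (\<Prod>j<N. W (p j) (\<nu> j)))"
    proof (rule sum_mono)
      fix p assume p: "p \<in> ?P"
      have "\<bar>signof p * (\<Prod>j<N. a j (\<nu> j) * C (p j) j (\<nu> j))\<bar> = (\<Prod>j<N. \<bar>a j (\<nu> j) * C (p j) j (\<nu> j)\<bar>)"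
        by (simp add: abs_mult abs_prod)
      also have "\<dots> \<le> (\<Prod>j<N. W (p j) (\<nu> j) * exp (- \<eta> * real (\<nu> j)))"
        using perm_lt[OF p] \<nu>_le by (intro prod_mono conjI G_le) auto
      also have "\<dots> = (\<Prod>j<N. W (p j) (\<nu> j)) * exp (- \<eta> * real (\<Sum>j<N. \<nu> j))"
        by (simp add: prod.distrib exp_sum[symmetric] sum_distrib_left sum_negf)
      also have "\<dots> \<le> (\<Prod>j<N. W (p j) (\<nu> j)) * exp (- \<eta> * real E)"
        using E_le assms(2) perm_lt[OF p]
        by (intro mult_left_mono prod_nonneg) (auto intro!: mult_left_mono W_nn simp del: of_nat_sum)
      finally show "\<bar>signof p * (\<Prod>j<N. a j (\<nu> j) * C (p j) j (\<nu> j))\<bar> \<le> exp (- \<eta> * real E) * (\<Prod>j<N. W (p j) (\<nu> j))"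
        by (simp add: mult.commute)
    qed
    finally show ?thesis by (simp add: sum_distrib_left)
  next
    case False
    then obtain j j' where jj: "j < N" "j' < N" "j \<noteq> j'" "\<nu> j = \<nu> j'" "\<nu> j < N"
      unfolding inj_on_def by auto
    \<comment> \<open>Once the cosines are pulled out of the rows, rows \<open>j\<close> and
      \<open>j'\<close> coincide, because they use the same index below \<open>N\<close>.\<close>
    let ?M = "mat N N (\<lambda>(j,i). C i j (\<nu> j))"
    have "T \<nu> = (\<Prod>j<N. a j (\<nu> j)) * det ?M"
      unfolding T_def det_mat_Leibniz by (simp add: prod.distrib sum_distrib_left mult.left_commute)
    also have "det ?M = 0"
      by (rule det_identical_rows[of _ N j j']) (use jj in \<open>auto simp: C_def\<close>)
    finally have "T \<nu> = 0" by simp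
    then show ?thesis
      using perm_lt by (auto intro!: mult_nonneg_nonneg sum_nonneg prod_nonneg W_nn)
  qed
  have "\<bar>det (mat N N (\<lambda>(j,i). f i j))\<bar> \<le> (\<Sum>\<nu>\<in>?V. \<bar>T \<nu>\<bar>)"
    unfolding det_eq by (rule sum_abs)
  also have "\<dots> \<le> (\<Sum>\<nu>\<in>?V. exp (- \<eta> * real E) * (\<Sum>p\<in>?P. \<Prod>j<N. W (p j) (\<nu> j)))"
    by (rule sum_mono) (rule T_le)
  also have "\<dots> = exp (- \<eta> * real E) * (\<Sum>p\<in>?P. \<Sum>\<nu>\<in>?V. \<Prod>j<N. W (p j) (\<nu> j))"
    unfolding sum_distrib_left[symmetric] by (subst sum.swap) simp
  also have "(\<Sum>p\<in>?P. \<Sum>\<nu>\<in>?V. \<Prod>j<N. W (p j) (\<nu> j)) = (\<Sum>p\<in>?P. \<Prod>j<N. \<Sum>n\<le>N. W (p j) n)"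
    by (intro sum.cong refl prod_sum_PiE[symmetric]) auto
  also have "(\<Sum>p\<in>?P. \<Prod>j<N. \<Sum>n\<le>N. W (p j) n) \<le> (\<Sum>p\<in>?P. \<Prod>j<N. 2 * F (p j))"
    using perm_lt by (intro sum_mono prod_mono conjI sum_nonneg W_nn W_sum) auto
  also have "\<dots> = (\<Sum>p\<in>?P. \<Prod>j<N. 2 * F j)"
    by (intro sum.cong refl prod.permute[symmetric, unfolded o_def]) auto
  also have "\<dots> = fact N * (2 ^ N * (\<Prod>j<N. F j))"
    by (simp add: card_permutations prod.distrib)
  finally show ?thesis
    by (simp add: E_def mult_ac)
qed

text \<open>The points are chosen one at a time. Laplace expansion along a new last row is a
  combination of the functions whose last coefficient is the previous minor; it is therefore
  nontrivial and nonzero at some point of \<open>E\<close>.\<close>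

lemma nonzero_minor_exists:
  fixes f :: "nat \<Rightarrow> 'a \<Rightarrow> 'b::field"
  assumes "\<And>c. (\<And>t. t \<in> E \<Longrightarrow> (\<Sum>i<n. c i * f i t) = 0) \<Longrightarrow> \<forall>i<n. c i = 0"
  shows "\<exists>t. (\<forall>j<n. t j \<in> E) \<and> det (mat n n (\<lambda>(j,i). f i (t j))) \<noteq> 0"
  using assms
proof (induction n)
  case 0
  then show ?case by auto
next
  case (Suc n)
  have "\<forall>i<n. c i = 0" if c: "\<And>t. t \<in> E \<Longrightarrow> (\<Sum>i<n. c i * f i t) = 0" for c
  proof -
    have "\<forall>i<Suc n. (if i < n then c i else 0) = 0"
      by (rule Suc.prems) (simp add: c)
    then show ?thesis by (auto dest: less_SucI)
  qed
  from Suc.IH[OF this] obtain t where t: "\<forall>j<n. t j \<in> E" "det (mat n n (\<lambda>(j,i). f i (t j))) \<noteq> 0"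
    by blast
  define A where "A x = mat (Suc n) (Suc n) (\<lambda>(j,i). f i (if j < n then t j else x))" for x
  \<comment> \<open>Deleting the last row removes the only dependence on \<open>x\<close>, so these
    cofactors may be taken at any argument.\<close>
  define c where "c i = cofactor (A undefined) n i" for i
  have cof: "cofactor (A x) n i = c i" if "i < Suc n" for x i
    unfolding cofactor_def c_def
    by (intro arg_cong2[of _ _ _ _ "(*)"] refl arg_cong[of _ _ det] eq_matI)
       (auto simp: mat_delete_def A_def)
  have det_A: "det (A x) = (\<Sum>i<Suc n. c i * f i x)" for x
  proof -
    have "det (A x) = (\<Sum>i<Suc n. A x $$ (n, i) * cofactor (A x) n i)"
      by (rule laplace_expansion_row) (auto simp: A_def)
    also have "\<dots> = (\<Sum>i<Suc n. c i * f i x)"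
      by (intro sum.cong refl) (simp only: cof lessThan_iff, simp add: A_def)
    finally show ?thesis .
  qed
  have "c n = det (mat n n (\<lambda>(j,i). f i (t j)))"
    unfolding c_def cofactor_def
    by (simp add: power_add[symmetric] mult_2[symmetric])
       (intro arg_cong[of _ _ det] eq_matI, auto simp: mat_delete_def A_def)
  then have "\<not> (\<forall>i<Suc n. c i = 0)" using t(2) by auto
  then obtain x where x: "x \<in> E" "(\<Sum>i<Suc n. c i * f i x) \<noteq> 0"
    using Suc.prems[of c] by blast
  show ?case
    by (rule exI[of _ "\<lambda>j. if j < n then t j else x"])
       (use x det_A[of x] t(1) in \<open>auto simp: A_def\<close>)
qed

section \<open>The Chebyshev norm as a submultiplicative norm\<close>

context
  fixes D :: "'a set" and \<theta> :: "'a \<Rightarrow> real" and N :: nat and \<eta> :: real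
begin

abbreviation (input) "chb \<equiv> cheb_norm_le D \<theta> N \<eta>"

lemma cheb_norm_le_mono: "chb f F \<Longrightarrow> F \<le> G \<Longrightarrow> chb f G"
  unfolding cheb_norm_le_def by (blast intro: order_trans)

lemma cheb_norm_le_cong:
  assumes "chb f F" "\<And>t. t \<in> D \<Longrightarrow> f t = g t"
  shows "chb g F"
  using assms(1) unfolding cheb_norm_le_def by (simp add: assms(2) cong: ball_cong)

lemma cheb_norm_le_bounded:
  assumes "\<And>t. t \<in> D \<Longrightarrow> \<bar>f t\<bar> \<le> B" "0 \<le> B"
  shows "chb f (B * cosh (real N * \<eta>))"
  unfolding cheb_norm_le_def
  by (rule exI[of _ "\<lambda>_. 0"], rule exI[of _ f], rule exI[of _ B]) (use assms in auto)

lemma cheb_norm_le_add: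
  assumes "chb f F" "chb g G"
  shows "chb (\<lambda>t. f t + g t) (F + G)"
proof -
  obtain c e B where 1: "0 \<le> B"
    "\<forall>t\<in>D. f t = (\<Sum>n<N. c n * cos (real n * \<theta> t)) + e t \<and> \<bar>e t\<bar> \<le> B"
    "(\<Sum>n<N. \<bar>c n\<bar> * cosh (real n * \<eta>)) + B * cosh (real N * \<eta>) \<le> F"
    using assms(1) unfolding cheb_norm_le_def by blast
  obtain c' e' B' where 2: "0 \<le> B'"
    "\<forall>t\<in>D. g t = (\<Sum>n<N. c' n * cos (real n * \<theta> t)) + e' t \<and> \<bar>e' t\<bar> \<le> B'"
    "(\<Sum>n<N. \<bar>c' n\<bar> * cosh (real n * \<eta>)) + B' * cosh (real N * \<eta>) \<le> G"
    using assms(2) unfolding cheb_norm_le_def by blast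
  have "(\<Sum>n<N. \<bar>c n + c' n\<bar> * cosh (real n * \<eta>)) \<le>
        (\<Sum>n<N. \<bar>c n\<bar> * cosh (real n * \<eta>)) + (\<Sum>n<N. \<bar>c' n\<bar> * cosh (real n * \<eta>))"
    unfolding sum.distrib[symmetric] distrib_right[symmetric]
    by (intro sum_mono mult_right_mono) auto
  then have "(\<Sum>n<N. \<bar>c n + c' n\<bar> * cosh (real n * \<eta>)) + (B + B') * cosh (real N * \<eta>) \<le> F + G"
    using 1(3) 2(3) by (simp add: distrib_right)
  moreover have "f t + g t = (\<Sum>n<N. (c n + c' n) * cos (real n * \<theta> t)) + (e t + e' t) \<and> \<bar>e t + e' t\<bar> \<le> B + B'"
    if "t \<in> D" for t
  proof -
    have "f t = (\<Sum>n<N. c n * cos (real n * \<theta> t)) + e t" "\<bar>e t\<bar> \<le> B"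
         "g t = (\<Sum>n<N. c' n * cos (real n * \<theta> t)) + e' t" "\<bar>e' t\<bar> \<le> B'"
      using 1(2) 2(2) that by auto
    then show ?thesis by (simp add: distrib_right sum.distrib)
  qed
  ultimately show ?thesis
    unfolding cheb_norm_le_def using 1(1) 2(1)
    by (intro exI[of _ "\<lambda>n. c n + c' n"] exI[of _ "\<lambda>t. e t + e' t"] exI[of _ "B + B'"]) auto
qed

lemma cheb_norm_le_scale:
  assumes "chb f F"
  shows "chb (\<lambda>t. a * f t) (\<bar>a\<bar> * F)"
proof -
  obtain c e B where 1: "0 \<le> B"
    "\<forall>t\<in>D. f t = (\<Sum>n<N. c n * cos (real n * \<theta> t)) + e t \<and> \<bar>e t\<bar> \<le> B"
    "(\<Sum>n<N. \<bar>c n\<bar> * cosh (real n * \<eta>)) + B * cosh (real N * \<eta>) \<le> F"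
    using assms(1) unfolding cheb_norm_le_def by blast
  have "(\<Sum>n<N. \<bar>a * c n\<bar> * cosh (real n * \<eta>)) + (\<bar>a\<bar> * B) * cosh (real N * \<eta>) =
      \<bar>a\<bar> * ((\<Sum>n<N. \<bar>c n\<bar> * cosh (real n * \<eta>)) + B * cosh (real N * \<eta>))"
    by (simp add: distrib_left sum_distrib_left abs_mult mult.assoc)
  also have "\<dots> \<le> \<bar>a\<bar> * F" using 1(3) by (intro mult_left_mono) auto
  finally have "(\<Sum>n<N. \<bar>a * c n\<bar> * cosh (real n * \<eta>)) + (\<bar>a\<bar> * B) * cosh (real N * \<eta>) \<le> \<bar>a\<bar> * F" .
  moreover have "a * f t = (\<Sum>n<N. (a * c n) * cos (real n * \<theta> t)) + a * e t \<and> \<bar>a * e t\<bar> \<le> \<bar>a\<bar> * B"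
    if "t \<in> D" for t
    using 1(2) that by (auto simp: distrib_left sum_distrib_left abs_mult mult.assoc intro: mult_left_mono)
  ultimately show ?thesis
    unfolding cheb_norm_le_def using 1(1)
    by (intro exI[of _ "\<lambda>n. a * c n"] exI[of _ "\<lambda>t. a * e t"] exI[of _ "\<bar>a\<bar> * B"]) auto
qed

lemma cheb_norm_le_zero: "chb (\<lambda>_. 0) 0"
  using cheb_norm_le_bounded[of "\<lambda>_. 0" 0] by simp

lemma cheb_norm_le_sum:
  assumes "\<And>i. i \<in> I \<Longrightarrow> chb (f i) (F i)"
  shows "chb (\<lambda>t. \<Sum>i\<in>I. f i t) (\<Sum>i\<in>I. F i)"
  using assms
proof (induction I rule: infinite_finite_induct)
  case (insert x I)
  then show ?case by (simp add: cheb_norm_le_add)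
qed (simp_all add: cheb_norm_le_zero)

lemma cheb_norm_le_abs:
  assumes "chb f F" "t \<in> D"
  shows "\<bar>f t\<bar> \<le> F"
proof -
  obtain c e B where 1: "0 \<le> B"
    "\<forall>t\<in>D. f t = (\<Sum>n<N. c n * cos (real n * \<theta> t)) + e t \<and> \<bar>e t\<bar> \<le> B"
    "(\<Sum>n<N. \<bar>c n\<bar> * cosh (real n * \<eta>)) + B * cosh (real N * \<eta>) \<le> F"
    using assms(1) unfolding cheb_norm_le_def by blast
  have "\<bar>f t\<bar> \<le> \<bar>\<Sum>n<N. c n * cos (real n * \<theta> t)\<bar> + \<bar>e t\<bar>"
    using 1(2) assms(2) by (simp add: abs_triangle_ineq)
  also have "\<bar>\<Sum>n<N. c n * cos (real n * \<theta> t)\<bar> \<le> (\<Sum>n<N. \<bar>c n\<bar> * cosh (real n * \<eta>))"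
    by (rule order_trans[OF sum_abs], rule sum_mono)
       (auto simp: abs_mult intro!: mult_left_mono intro: order_trans[OF abs_cos_le_one cosh_real_ge_1])
  also have "\<bar>e t\<bar> \<le> B * cosh (real N * \<eta>)"
    using 1 assms(2) mult_left_mono[OF cosh_real_ge_1 1(1), of "real N * \<eta>"] by force
  finally show ?thesis using 1(3) by linarith
qed

lemma cheb_norm_le_cos:
  assumes "0 \<le> \<eta>"
  shows "chb (\<lambda>t. cos (real n * \<theta> t)) (cosh (real n * \<eta>))"
proof (cases "n < N")
  case True
  have *: "(\<Sum>i<N. (if i = n then 1 else 0) * h i) = h n" for h :: "nat \<Rightarrow> real"
    using True by (subst sum.mono_neutral_right[of _ "{n}"]) auto
  have **: "\<bar>if i = n then 1 else 0\<bar> = (if i = n then 1 else 0 :: real)" for i by simp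
  show ?thesis
    unfolding cheb_norm_le_def
    by (rule exI[of _ "\<lambda>i. if i = n then 1 else 0"], rule exI[of _ "\<lambda>_. 0"], rule exI[of _ 0])
       (simp only: * **, simp)
next
  \<comment> \<open>A frequency of at least \<open>N\<close> counts as a remainder bounded by 1, and
    its weight \<open>cosh (N * \<eta>)\<close> does not exceed
    \<open>cosh (n * \<eta>)\<close>.\<close>
  case False
  have "chb (\<lambda>t. cos (real n * \<theta> t)) (1 * cosh (real N * \<eta>))"
    by (rule cheb_norm_le_bounded) auto
  moreover have "cosh (real N * \<eta>) \<le> cosh (real n * \<eta>)"
    using False assms by (subst cosh_real_nonneg_le_iff) (auto intro: mult_right_mono)
  ultimately show ?thesis by (auto intro: cheb_norm_le_mono)
qed

text \<open>The weights \<open>cosh (n \<eta>)\<close> satisfy the same product formula as the functions \<open>cos (n \<theta>)\<close>; hence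
  the norm is submultiplicative.\<close>

lemma cheb_norm_le_cos_mult:
  assumes "0 \<le> \<eta>"
  shows "chb (\<lambda>t. cos (real m * \<theta> t) * cos (real n * \<theta> t)) (cosh (real m * \<eta>) * cosh (real n * \<eta>))"
proof -
  have main: "chb (\<lambda>t. cos (real m * \<theta> t) * cos (real n * \<theta> t)) (cosh (real m * \<eta>) * cosh (real n * \<eta>))"
    if "n \<le> m" for m n
  proof -
    have "chb (\<lambda>t. (1/2) * (cos (real (m - n) * \<theta> t) + cos (real (m + n) * \<theta> t)))
        (\<bar>1/2\<bar> * (cosh (real (m - n) * \<eta>) + cosh (real (m + n) * \<eta>)))"
      by (intro cheb_norm_le_scale cheb_norm_le_add cheb_norm_le_cos assms)
    moreover have "\<bar>1/2\<bar> * (cosh (real (m - n) * \<eta>) + cosh (real (m + n) * \<eta>)) = cosh (real m * \<eta>) * cosh (real n * \<eta>)"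
      using that by (simp add: of_nat_diff left_diff_distrib distrib_right cosh_add cosh_diff)
    moreover have "(1/2) * (cos (real (m - n) * \<theta> t) + cos (real (m + n) * \<theta> t)) = cos (real m * \<theta> t) * cos (real n * \<theta> t)" for t
      using that by (simp add: of_nat_diff left_diff_distrib distrib_right cos_add cos_diff)
    ultimately show ?thesis by simp
  qed
  show ?thesis
    using main[of n m] main[of m n] by (cases "n \<le> m") (auto simp: mult.commute)
qed

lemma cheb_norm_le_mult:
  assumes "chb f F" "chb g G" "0 \<le> \<eta>" and ne: "D \<noteq> {}"
  shows "chb (\<lambda>t. f t * g t) (F * G)"
proof -
  obtain c e B where 1: "0 \<le> B"
    "\<forall>t\<in>D. f t = (\<Sum>n<N. c n * cos (real n * \<theta> t)) + e t \<and> \<bar>e t\<bar> \<le> B"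
    "(\<Sum>n<N. \<bar>c n\<bar> * cosh (real n * \<eta>)) + B * cosh (real N * \<eta>) \<le> F"
    using assms(1) unfolding cheb_norm_le_def by blast
  obtain c' e' B' where 2: "0 \<le> B'"
    "\<forall>t\<in>D. g t = (\<Sum>n<N. c' n * cos (real n * \<theta> t)) + e' t \<and> \<bar>e' t\<bar> \<le> B'"
    "(\<Sum>n<N. \<bar>c' n\<bar> * cosh (real n * \<eta>)) + B' * cosh (real N * \<eta>) \<le> G"
    using assms(2) unfolding cheb_norm_le_def by blast
  define P where "P = (\<Sum>n<N. \<bar>c n\<bar> * cosh (real n * \<eta>))"
  define P' where "P' = (\<Sum>n<N. \<bar>c' n\<bar> * cosh (real n * \<eta>))"
  let ?w = "cosh (real N * \<eta>)"
  have P_nn: "0 \<le> P" "0 \<le> P'" unfolding P_def P'_def by (auto intro!: sum_nonneg)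
  have G0: "0 \<le> G" using cheb_norm_le_abs[OF assms(2)] ne by fastforce
  have "chb (\<lambda>t. (\<Sum>m<N. \<Sum>n<N. (c m * c' n) * (cos (real m * \<theta> t) * cos (real n * \<theta> t))))
     (\<Sum>m<N. \<Sum>n<N. \<bar>c m * c' n\<bar> * (cosh (real m * \<eta>) * cosh (real n * \<eta>)))"
    by (intro cheb_norm_le_sum cheb_norm_le_scale cheb_norm_le_cos_mult assms)
  also have "(\<lambda>t. (\<Sum>m<N. \<Sum>n<N. (c m * c' n) * (cos (real m * \<theta> t) * cos (real n * \<theta> t)))) =
     (\<lambda>t. (\<Sum>m<N. c m * cos (real m * \<theta> t)) * (\<Sum>n<N. c' n * cos (real n * \<theta> t)))"
    unfolding sum_product by (intro ext sum.cong refl) (simp add: mult_ac)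
  also have "(\<Sum>m<N. \<Sum>n<N. \<bar>c m * c' n\<bar> * (cosh (real m * \<eta>) * cosh (real n * \<eta>))) = P * P'"
    unfolding P_def P'_def sum_product by (intro sum.cong refl) (simp add: mult_ac abs_mult)
  finally have A: "chb (\<lambda>t. (\<Sum>m<N. c m * cos (real m * \<theta> t)) * (\<Sum>n<N. c' n * cos (real n * \<theta> t))) (P * P')" .
  have P_le: "\<bar>\<Sum>n<N. c n * cos (real n * \<theta> t)\<bar> \<le> P" for t
    unfolding P_def
    by (rule order_trans[OF sum_abs], rule sum_mono)
       (auto simp: abs_mult intro!: mult_left_mono intro: order_trans[OF abs_cos_le_one cosh_real_ge_1])
  \<comment> \<open>Every product involving a remainder joins the new remainder: the main part of
    \<open>f\<close> times \<open>e'\<close>, and \<open>e\<close> times all of \<open>g\<close>,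
    where \<open>g\<close> is bounded by its full norm \<open>G\<close>.\<close>
  have Bd: "chb (\<lambda>t. (\<Sum>m<N. c m * cos (real m * \<theta> t)) * e' t + e t * g t) ((P * B' + B * G) * ?w)"
  proof (rule cheb_norm_le_bounded)
    fix t assume t: "t \<in> D"
    have "\<bar>\<Sum>m<N. c m * cos (real m * \<theta> t)\<bar> * \<bar>e' t\<bar> \<le> P * B'"
      using 2(2) t P_nn by (intro mult_mono P_le) auto
    moreover have "\<bar>e t\<bar> * \<bar>g t\<bar> \<le> B * G"
      using 1 t cheb_norm_le_abs[OF assms(2) t] by (intro mult_mono) auto
    ultimately show "\<bar>(\<Sum>m<N. c m * cos (real m * \<theta> t)) * e' t + e t * g t\<bar> \<le> P * B' + B * G"
      by (intro order_trans[OF abs_triangle_ineq]) (simp add: abs_mult)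
  qed (use P_nn 1 2 G0 in auto)
  have "chb (\<lambda>t. f t * g t) (P * P' + (P * B' + B * G) * ?w)"
  proof (rule cheb_norm_le_cong[OF cheb_norm_le_add[OF A Bd]])
    fix t assume "t \<in> D"
    then have f: "f t = (\<Sum>n<N. c n * cos (real n * \<theta> t)) + e t"
      and g: "g t = (\<Sum>n<N. c' n * cos (real n * \<theta> t)) + e' t" using 1 2 by auto
    show "(\<Sum>m<N. c m * cos (real m * \<theta> t)) * (\<Sum>n<N. c' n * cos (real n * \<theta> t)) +
         ((\<Sum>m<N. c m * cos (real m * \<theta> t)) * e' t + e t * g t) = f t * g t"
      unfolding f g by (simp add: algebra_simps)
  qed
  moreover have "P * P' + (P * B' + B * G) * ?w \<le> F * G"
  proof -
    have "P * (P' + B' * ?w) \<le> P * G"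
      using 2(3) P_nn unfolding P'_def by (intro mult_left_mono) auto
    moreover have "(P + B * ?w) * G \<le> F * G"
      using 1(3) G0 unfolding P_def by (intro mult_right_mono) auto
    ultimately show ?thesis by (simp add: algebra_simps)
  qed
  ultimately show ?thesis by (rule cheb_norm_le_mono)
qed

lemma cheb_norm_le_const: "0 \<le> \<eta> \<Longrightarrow> chb (\<lambda>_. a) \<bar>a\<bar>"
  using cheb_norm_le_scale[OF cheb_norm_le_cos[of 0], of a] by simp

lemma cheb_norm_le_power:
  assumes "chb f F" "0 \<le> \<eta>" "D \<noteq> {}"
  shows "chb (\<lambda>t. f t ^ n) (F ^ n)"
proof (induction n)
  case 0
  show ?case using cheb_norm_le_const[of 1] assms by simp
next
  case (Suc n)
  show ?case using cheb_norm_le_mult[OF assms(1) Suc assms(2,3)] by simp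
qed

lemma cheb_norm_le_prod:
  assumes "\<And>i. i \<in> I \<Longrightarrow> chb (f i) (F i)" "0 \<le> \<eta>" "D \<noteq> {}"
  shows "chb (\<lambda>t. \<Prod>i\<in>I. f i t) (\<Prod>i\<in>I. F i)"
  using assms(1)
proof (induction I rule: infinite_finite_induct)
  case (insert x I)
  then show ?case using cheb_norm_le_mult[OF _ _ assms(2,3)] by simp
qed (use cheb_norm_le_const[of 1] assms in simp_all)

lemma cheb_norm_le_gbinomial:
  assumes "chb f F" "0 \<le> \<eta>" "D \<noteq> {}" "real k \<le> M"
  shows "chb (\<lambda>t. f t gchoose k) ((F + M) ^ k / fact k)"
proof -
  have "chb (\<lambda>t. \<Prod>i<k. f t + (- real i)) (\<Prod>i<k. F + \<bar>- real i\<bar>)"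
    by (intro cheb_norm_le_prod cheb_norm_le_add cheb_norm_le_const assms)
  then have "chb (\<lambda>t. (1 / fact k) * (\<Prod>i<k. f t + (- real i))) (\<bar>1 / fact k\<bar> * (\<Prod>i<k. F + \<bar>- real i\<bar>))"
    by (rule cheb_norm_le_scale)
  moreover have "(1 / fact k) * (\<Prod>i<k. f t + (- real i)) = f t gchoose k" for t
    by (simp add: gbinomial_prod_rev atLeast0LessThan)
  moreover have "\<bar>1 / fact k\<bar> * (\<Prod>i<k. F + \<bar>- real i\<bar>) \<le> (F + M) ^ k / fact k"
  proof -
    have "0 \<le> F" using cheb_norm_le_abs[OF assms(1)] assms(3) by fastforce
    then have "(\<Prod>i<k. F + \<bar>- real i\<bar>) \<le> (\<Prod>i<k. F + M)"
      using assms(4) by (intro prod_mono) auto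
    then show ?thesis by (simp add: divide_right_mono)
  qed
  ultimately show ?thesis by (auto intro: cheb_norm_le_mono)
qed

text \<open>Submultiplicativity controls a Taylor polynomial by its value at \<open>F\<close>; the
  Taylor tail becomes a bounded remainder. The weight \<open>cosh (N * \<eta>)\<close> of that
  remainder is fixed, so a large enough degree makes its cost at most
  \<open>\<epsilon>\<close>.\<close>

lemma cheb_norm_le_exp:
  assumes "chb f F" "0 \<le> \<eta>" "D \<noteq> {}" "\<epsilon> > 0"
  shows "chb (\<lambda>t. exp (f t)) (exp F + \<epsilon>)"
proof -
  have F0: "0 \<le> F" using cheb_norm_le_abs[OF assms(1)] assms(3) by fastforce
  let ?w = "cosh (real N * \<eta>)"
  have w: "?w > 0" by simp
  define T where "T n x = (\<Sum>i<n. x ^ i / fact i)" for n and x :: real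
  have lim: "(\<lambda>n. T n F) \<longlonglongrightarrow> exp F"
    using exp_converges[of F] by (simp add: sums_def T_def scaleR_conv_of_real field_simps)
  then have "eventually (\<lambda>n. dist (T n F) (exp F) < \<epsilon> / ?w) sequentially"
    using assms(4) by (intro tendstoD) auto
  then obtain n where n: "\<bar>T n F - exp F\<bar> < \<epsilon> / ?w"
    unfolding eventually_sequentially dist_real_def by blast
  have T_le: "\<bar>exp x - T n x\<bar> \<le> exp F - T n F" if "\<bar>x\<bar> \<le> F" for x
  proof -
    have s: "(\<lambda>i. z ^ (i + n) / fact (i + n)) sums (exp z - T n z)" for z :: real
      unfolding T_def using sums_split_initial_segment[OF exp_converges[of z], of n]
      by (simp add: scaleR_conv_of_real field_simps)
    have "norm (\<Sum>i. x ^ (i + n) / fact (i + n)) \<le> (\<Sum>i. F ^ (i + n) / fact (i + n))"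
      using that by (intro norm_suminf_le sums_summable[OF s])
        (auto simp: power_abs intro!: divide_right_mono power_mono)
    then show ?thesis using s[of x] s[of F] by (simp add: sums_iff)
  qed
  have "chb (\<lambda>t. \<Sum>i<n. (1 / fact i) * f t ^ i) (\<Sum>i<n. \<bar>1 / fact i\<bar> * F ^ i)"
    by (intro cheb_norm_le_sum cheb_norm_le_scale cheb_norm_le_power assms)
  then have 1: "chb (\<lambda>t. T n (f t)) (T n F)"
    by (simp add: T_def)
  have 2: "chb (\<lambda>t. exp (f t) - T n (f t)) ((exp F - T n F) * ?w)"
  proof (rule cheb_norm_le_bounded)
    show "\<bar>exp (f t) - T n (f t)\<bar> \<le> exp F - T n F" if "t \<in> D" for t
      by (rule T_le) (use cheb_norm_le_abs[OF assms(1) that] in auto)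
    show "0 \<le> exp F - T n F" using T_le[of F] F0 by auto
  qed
  have "chb (\<lambda>t. exp (f t)) (T n F + (exp F - T n F) * ?w)"
    using cheb_norm_le_add[OF 1 2] by simp
  moreover have "T n F + (exp F - T n F) * ?w \<le> exp F + \<epsilon>"
  proof -
    have "T n F \<le> exp F" using T_le[of F] F0 by auto
    moreover have "(exp F - T n F) * ?w \<le> \<epsilon>"
    proof -
      have "exp F - T n F < \<epsilon> / ?w" using n by linarith
      then show ?thesis using w by (simp add: pos_less_divide_eq)
    qed
    ultimately show ?thesis by linarith
  qed
  ultimately show ?thesis by (rule cheb_norm_le_mono)
qed

end

section \<open>Zero estimate\<close>

lemma coeff_mult_degree_bounds:
  fixes p q :: "'a::comm_semiring_0 poly"
  assumes "degree p \<le> m" "degree q \<le> n"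
  shows "coeff (p * q) (m + n) = coeff p m * coeff q n"
proof -
  have "coeff (p * q) (m + n) = (\<Sum>i\<le>m+n. coeff p i * coeff q (m + n - i))"
    by (rule coeff_mult)
  also have "\<dots> = (\<Sum>i\<in>{m}. coeff p i * coeff q (m + n - i))"
  proof (rule sum.mono_neutral_right)
    show "\<forall>i\<in>{..m + n} - {m}. coeff p i * coeff q (m + n - i) = 0"
    proof
      fix i assume i: "i \<in> {..m + n} - {m}"
      show "coeff p i * coeff q (m + n - i) = 0"
      proof (cases "i < m")
        case True
        then have "degree q < m + n - i" using assms by linarith
        then show ?thesis by (simp add: coeff_eq_0)
      next
        case False
        then have "degree p < i" using i assms by auto
        then show ?thesis by (simp add: coeff_eq_0)
      qed
    qed
  qed auto
  finally show ?thesis by simp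
qed

lemma coeff_prod_degree_bounds:
  fixes q :: "'i \<Rightarrow> 'a::comm_semiring_1 poly"
  assumes "finite I" "\<And>i. i \<in> I \<Longrightarrow> degree (q i) \<le> d i"
  shows "coeff (\<Prod>i\<in>I. q i) (\<Sum>i\<in>I. d i) = (\<Prod>i\<in>I. coeff (q i) (d i))"
  using assms
proof (induction I rule: finite_induct)
  case (insert x I)
  have "degree (\<Prod>i\<in>I. q i) \<le> (\<Sum>i\<in>I. degree (q i))"
    using degree_prod_sum_le[of I q] insert.hyps by (simp add: o_def)
  also have "\<dots> \<le> (\<Sum>i\<in>I. d i)" using insert.prems by (intro sum_mono) auto
  finally have "coeff (q x * (\<Prod>i\<in>I. q i)) (d x + (\<Sum>i\<in>I. d i)) = coeff (q x) (d x) * coeff (\<Prod>i\<in>I. q i) (\<Sum>i\<in>I. d i)"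
    using insert.prems by (intro coeff_mult_degree_bounds) auto
  then show ?case using insert by simp
qed simp

text \<open>The translates of \<open>\<Sum>P\<^sub>l(X) Y\<^sup>l\<close> by points of \<open>E1\<close> form a linear system in the powers of \<open>v t\<close> whose
  determinant is a polynomial in \<open>z t\<close> vanishing on \<open>z ` E2\<close>; its leading coefficient is a nonzero
  generalised Vandermonde determinant.\<close>

lemma zero_estimate:
  fixes P :: "nat \<Rightarrow> real poly" and z v :: "'a \<Rightarrow> real"
  assumes deg: "\<And>l. l < L \<Longrightarrow> degree (P l) \<le> K"
    and vanish: "\<And>s t. s \<in> E1 \<Longrightarrow> t \<in> E2 \<Longrightarrow> (\<Sum>l<L. poly (P l) (z s + z t) * (v s * v t) ^ l) = 0"
    and v0: "\<And>t. t \<in> E2 \<Longrightarrow> v t \<noteq> 0"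
    and card1: "finite E1" "L \<le> card (v ` E1)"
    and card2: "finite E2" "K * L < card (z ` E2)"
  shows "\<forall>l<L. P l = 0"
proof (rule ccontr)
  assume not0: "\<not> (\<forall>l<L. P l = 0)"
  \<comment> \<open>Only the nonzero polynomials are kept, so that all leading coefficients below
    are nonzero.\<close>
  define I where "I = {l. l < L \<and> P l \<noteq> 0}"
  define n where "n = card I"
  have finI: "finite I" unfolding I_def by auto
  have n0: "n > 0" unfolding n_def using not0 finI by (auto simp: card_gt_0_iff I_def)
  have nL: "n \<le> L" unfolding n_def using card_mono[of "{..<L}" I] by (auto simp: I_def)
  obtain e where e: "bij_betw e {..<n} I"
    using ex_bij_betw_nat_finite[OF finI] unfolding n_def atLeast0LessThan by blast
  have eI: "e i < L" "P (e i) \<noteq> 0" if "i < n" for i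
    using bij_betwE[OF e] that by (auto simp: I_def)
  have "\<exists>t. (\<forall>j<n. t j \<in> E1) \<and> det (mat n n (\<lambda>(j,i). v (t j) ^ e i)) \<noteq> 0"
  proof (rule nonzero_minor_exists)
    fix c assume c: "\<And>t. t \<in> E1 \<Longrightarrow> (\<Sum>i<n. c i * v t ^ e i) = 0"
    define q where "q = (\<Sum>i<n. monom (c i) (e i))"
    have "q = 0"
    proof (rule ccontr)
      assume q: "q \<noteq> 0"
      have "poly q (v t) = 0" if "t \<in> E1" for t
        using c[OF that] by (simp add: q_def poly_sum poly_monom)
      then have "v ` E1 \<subseteq> {x. poly q x = 0}" by blast
      then have "card (v ` E1) \<le> card {x. poly q x = 0}"
        by (intro card_mono poly_roots_finite q)
      also have "\<dots> \<le> degree q" by (rule card_poly_roots_bound[OF q])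
      also have "degree q \<le> L - 1"
        unfolding q_def
      proof (rule degree_sum_le)
        fix i assume "i \<in> {..<n}"
        then have "e i \<le> L - 1" using eI(1)[of i] by auto
        then show "degree (monom (c i) (e i)) \<le> L - 1"
          using degree_monom_le[of "c i" "e i"] by (rule order_trans[rotated])
      qed simp
      finally show False using card1 n0 nL by linarith
    qed
    show "\<forall>i<n. c i = 0"
    proof (intro allI impI)
      fix i assume i: "i < n"
      have "coeff q (e i) = (\<Sum>j<n. if j = i then c j else 0)"
        unfolding q_def coeff_sum coeff_monom
        by (intro sum.cong refl) (use i e in \<open>auto simp: bij_betw_def inj_on_def\<close>)
      then show "c i = 0" using \<open>q = 0\<close> i by simp
    qed
  qed
  then obtain t where t: "\<And>j. j < n \<Longrightarrow> t j \<in> E1" and det0: "det (mat n n (\<lambda>(j,i). v (t j) ^ e i)) \<noteq> 0"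
    by blast
  \<comment> \<open>Column \<open>i\<close> belongs to the unknown \<open>Y ^ e i\<close>, row
    \<open>j\<close> to the translation by the point \<open>t j\<close>.\<close>
  define h where "h j i = smult (v (t j) ^ e i) (P (e i) \<circ>\<^sub>p [:z (t j), 1:])" for j i
  define Q where "Q = det (mat n n (\<lambda>(j,i). h j i))"
  define d where "d = (\<Sum>i<n. degree (P (e i)))"
  have deg_h: "degree (h j i) \<le> degree (P (e i))" for j i
    unfolding h_def by (rule order_trans[OF degree_smult_le]) (simp add: degree_pcompose)
  have coeff_h: "coeff (h j i) (degree (P (e i))) = v (t j) ^ e i * lead_coeff (P (e i))" for j i
  proof -
    have "lead_coeff (P (e i) \<circ>\<^sub>p [:z (t j), 1:]) = lead_coeff (P (e i)) * lead_coeff [:z (t j), 1:] ^ degree (P (e i))"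
      by (rule lead_coeff_comp) simp
    then show ?thesis unfolding h_def by (simp add: degree_pcompose)
  qed
  have perm_lt: "p j < n" if "p permutes {..<n}" "j < n" for p j
    using permutes_in_image[OF that(1), of j] that(2) by auto
  \<comment> \<open>Translation preserves leading coefficients, so the coefficient of
    \<open>Q\<close> at the largest possible degree \<open>d\<close> factors into the
    Vandermonde-type determinant and the product of the leading coefficients.\<close>
  have "coeff Q d = (\<Sum>p | p permutes {..<n}. signof p * (\<Prod>j<n. v (t j) ^ e (p j)) * (\<Prod>i<n. lead_coeff (P (e i))))"
    unfolding Q_def det_mat_Leibniz coeff_sum
  proof (intro sum.cong refl)
    fix p assume "p \<in> {p. p permutes {..<n}}"
    then have p: "p permutes {..<n}" by simp
    have d: "d = (\<Sum>j<n. degree (P (e (p j))))"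
      unfolding d_def using sum.permute[OF p, of "\<lambda>i. degree (P (e i))"] by (simp add: o_def)
    have "coeff (\<Prod>j<n. h j (p j)) d = (\<Prod>j<n. coeff (h j (p j)) (degree (P (e (p j)))))"
      unfolding d by (rule coeff_prod_degree_bounds) (auto simp: deg_h)
    also have "\<dots> = (\<Prod>j<n. v (t j) ^ e (p j)) * (\<Prod>j<n. lead_coeff (P (e (p j))))"
      by (simp add: coeff_h prod.distrib)
    also have "(\<Prod>j<n. lead_coeff (P (e (p j)))) = (\<Prod>i<n. lead_coeff (P (e i)))"
      using prod.permute[OF p, of "\<lambda>i. lead_coeff (P (e i))"] by (simp add: o_def)
    finally have "coeff (\<Prod>j<n. h j (p j)) d = (\<Prod>j<n. v (t j) ^ e (p j)) * (\<Prod>i<n. lead_coeff (P (e i)))" .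
    then show "coeff (signof p * (\<Prod>j<n. h j (p j))) d = signof p * (\<Prod>j<n. v (t j) ^ e (p j)) * (\<Prod>i<n. lead_coeff (P (e i)))"
      by (simp add: sign_def)
  qed
  also have "\<dots> = det (mat n n (\<lambda>(j,i). v (t j) ^ e i)) * (\<Prod>i<n. lead_coeff (P (e i)))"
    unfolding det_mat_Leibniz by (simp add: sum_distrib_right)
  finally have "coeff Q d \<noteq> 0" using det0 eI by auto
  then have Q0: "Q \<noteq> 0" by auto
  have roots: "poly Q (z s) = 0" if s: "s \<in> E2" for s
  proof -
    let ?A = "mat n n (\<lambda>(j,i). poly (h j i) (z s))"
    let ?x = "vec n (\<lambda>i. v s ^ e i)"
    interpret hom: comm_ring_hom "\<lambda>q. poly q (z s)" by unfold_locales auto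
    have "poly Q (z s) = det (map_mat (\<lambda>q. poly q (z s)) (mat n n (\<lambda>(j,i). h j i)))"
      unfolding Q_def by (rule hom.hom_det[symmetric])
    also have "map_mat (\<lambda>q. poly q (z s)) (mat n n (\<lambda>(j,i). h j i)) = ?A"
      by (rule eq_matI) auto
    also have "det ?A = 0"
    proof -
      \<comment> \<open>The vanishing hypothesis says exactly that the vector of powers of
        \<open>v s\<close> lies in the kernel; it is nonzero because \<open>v s\<close> is.\<close>
      have "?A *\<^sub>v ?x = 0\<^sub>v n"
      proof (rule eq_vecI)
        fix j assume "j < dim_vec (0\<^sub>v n)"
        then have j: "j < n" by simp
        have "(?A *\<^sub>v ?x) $ j = (\<Sum>i<n. poly (h j i) (z s) * v s ^ e i)"
          using j by (simp add: scalar_prod_def atLeast0LessThan)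
        also have "\<dots> = (\<Sum>i<n. poly (P (e i)) (z (t j) + z s) * (v (t j) * v s) ^ e i)"
          by (intro sum.cong refl) (simp add: h_def poly_pcompose power_mult_distrib mult_ac)
        also have "\<dots> = (\<Sum>l\<in>I. poly (P l) (z (t j) + z s) * (v (t j) * v s) ^ l)"
          by (rule sum.reindex_bij_betw[OF e])
        also have "\<dots> = (\<Sum>l<L. poly (P l) (z (t j) + z s) * (v (t j) * v s) ^ l)"
          by (rule sum.mono_neutral_left) (auto simp: I_def)
        also have "\<dots> = 0" by (rule vanish[OF t[OF j] s])
        finally show "(?A *\<^sub>v ?x) $ j = 0\<^sub>v n $ j" using j by simp
      qed simp
      moreover have "?x \<noteq> 0\<^sub>v n"
      proof
        assume "?x = 0\<^sub>v n"
        then have "?x $ 0 = 0\<^sub>v n $ 0" by simp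
        then show False using n0 v0[OF s] by simp
      qed
      ultimately show ?thesis
        by (subst det_0_iff_vec_prod_zero_field[of _ n]) (auto intro!: exI[of _ ?x])
    qed
    finally show ?thesis .
  qed
  have "z ` E2 \<subseteq> {x. poly Q x = 0}" using roots by auto
  then have "card (z ` E2) \<le> card {x. poly Q x = 0}"
    by (intro card_mono poly_roots_finite Q0)
  also have "\<dots> \<le> degree Q" by (rule card_poly_roots_bound[OF Q0])
  also have "degree Q \<le> K * n"
    unfolding Q_def
    by (rule degree_det_le) (use eI in \<open>auto intro!: order_trans[OF deg_h] deg\<close>)
  also have "\<dots> \<le> K * L" using nL by simp
  finally show False using card2 by simp
qed

text \<open>The index \<open>i = l * K + k\<close> encodes the pair of a binomial degree
  \<open>k\<close> and an exponent \<open>l\<close>. Grouping by \<open>l\<close> gives polynomials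
  of degree at most \<open>K - 1\<close>, to which \<open>zero_estimate\<close> applies.\<close>

lemma gbinomial_exponential_independent:
  fixes z v :: "'a \<Rightarrow> real" and c :: "nat \<Rightarrow> real"
  assumes vanish: "\<And>s t. s \<in> E1 \<Longrightarrow> t \<in> E2 \<Longrightarrow>
      (\<Sum>i<K * L. c i * (((z s + z t) gchoose (i mod K)) * (v s * v t) ^ (i div K))) = 0"
    and v0: "\<And>t. t \<in> E2 \<Longrightarrow> v t \<noteq> 0"
    and card1: "finite E1" "L \<le> card (v ` E1)"
    and card2: "finite E2" "(K - 1) * L < card (z ` E2)"
  shows "\<forall>i<K * L. c i = 0"
proof (cases "K = 0")
  case False
  define b where "b k = smult (1 / fact k) (\<Prod>i<k. [:- real i, 1:])" for k
  have poly_b: "poly (b k) x = x gchoose k" for k x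
    by (simp add: b_def poly_prod gbinomial_prod_rev atLeast0LessThan)
  have deg_b: "degree (b k) \<le> k" for k
  proof -
    have "degree (\<Prod>i<k. [:- real i, 1:]) \<le> (\<Sum>i<k. degree [:- real i, 1:])"
      using degree_prod_sum_le[of "{..<k}" "\<lambda>i. [:- real i, 1:]"] by (simp add: o_def)
    then show ?thesis unfolding b_def by (auto intro: order_trans[OF degree_smult_le])
  qed
  define P where "P l = (\<Sum>k<K. smult (c (l * K + k)) (b k))" for l
  have split: "(\<Sum>i<K * L. g i) = (\<Sum>l<L. \<Sum>k<K. g (l * K + k))" for g :: "nat \<Rightarrow> real"
  proof -
    have "sum g {l * K..<l * K + K} = (\<Sum>k<K. g (l * K + k))" for l
      by (rule sum.reindex_bij_witness[of _ "\<lambda>k. l * K + k" "\<lambda>i. i - l * K"]) auto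
    then show ?thesis using sum.nat_group[of g K L] by (simp add: mult.commute)
  qed
  have "\<forall>l<L. P l = 0"
  proof (rule zero_estimate[where K = "K - 1", OF _ _ v0 card1 card2])
    show "degree (P l) \<le> K - 1" if "l < L" for l
      unfolding P_def by (intro degree_sum_le) (auto intro!: order_trans[OF degree_smult_le] order_trans[OF deg_b])
  next
    fix s t assume st: "s \<in> E1" "t \<in> E2"
    have "(\<Sum>l<L. poly (P l) (z s + z t) * (v s * v t) ^ l) =
        (\<Sum>i<K * L. c i * (((z s + z t) gchoose (i mod K)) * (v s * v t) ^ (i div K)))"
      unfolding split P_def poly_sum sum_distrib_right
      by (intro sum.cong refl) (auto simp: poly_b mult_ac)
    then show "(\<Sum>l<L. poly (P l) (z s + z t) * (v s * v t) ^ l) = 0"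
      using vanish[OF st] by simp
  qed
  \<comment> \<open>Evaluating \<open>P l\<close> at 0, 1, 2, ... gives a triangular system with
    unit diagonal, since \<open>k choose j\<close> vanishes for \<open>j > k\<close>.\<close>
  have "c (l * K + k) = 0" if "l < L" "k < K" for l k
    using that(2)
  proof (induction k rule: less_induct)
    case (less k)
    have "0 = poly (P l) (real k)" using \<open>\<forall>l<L. P l = 0\<close> that by simp
    also have "\<dots> = (\<Sum>j<K. c (l * K + j) * real (k choose j))"
      by (simp add: P_def poly_sum poly_b binomial_gbinomial)
    also have "\<dots> = (\<Sum>j\<in>{k}. c (l * K + j) * real (k choose j))"
      using less by (intro sum.mono_neutral_right) (auto simp: not_less_iff_gr_or_eq intro!: binomial_eq_0)
    finally show ?case by simp
  qed
  then show ?thesis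
    using False by (metis (no_types) div_mult_mod_eq less_mult_imp_div_less mod_less_divisor mult.commute neq0_conv)
qed simp

section \<open>Descent in the ring \<open>\<int>[\<surd>2]\<close>\<close>

datatype zsqrt2 = ZS (rat: int) (irr: int)

instantiation zsqrt2 :: comm_ring_1
begin
definition "0 = ZS 0 0"
definition "1 = ZS 1 0"
definition "u + v = ZS (rat u + rat v) (irr u + irr v)"
definition "u - v = ZS (rat u - rat v) (irr u - irr v)"
definition "- u = ZS (- rat u) (- irr u)"
definition "u * v = ZS (rat u * rat v + 2 * irr u * irr v) (rat u * irr v + irr u * rat v)"
instance
  by standard (auto simp: zero_zsqrt2_def one_zsqrt2_def plus_zsqrt2_def minus_zsqrt2_def
      uminus_zsqrt2_def times_zsqrt2_def algebra_simps)
end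

lemma rat_simps [simp]:
  "rat 0 = 0" "rat 1 = 1" "rat (u + v) = rat u + rat v" "rat (u - v) = rat u - rat v"
  "rat (- u) = - rat u" "rat (u * v) = rat u * rat v + 2 * irr u * irr v"
  by (simp_all add: zero_zsqrt2_def one_zsqrt2_def plus_zsqrt2_def minus_zsqrt2_def
      uminus_zsqrt2_def times_zsqrt2_def)

lemma irr_simps [simp]:
  "irr 0 = 0" "irr 1 = 0" "irr (u + v) = irr u + irr v" "irr (u - v) = irr u - irr v"
  "irr (- u) = - irr u" "irr (u * v) = rat u * irr v + irr u * rat v"
  by (simp_all add: zero_zsqrt2_def one_zsqrt2_def plus_zsqrt2_def minus_zsqrt2_def
      uminus_zsqrt2_def times_zsqrt2_def)

lemma zsqrt2_eq_iff: "u = v \<longleftrightarrow> rat u = rat v \<and> irr u = irr v"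
  by (cases u; cases v) auto

lemma of_nat_zsqrt2 [simp]: "rat (of_nat n) = int n" "irr (of_nat n) = 0"
  by (induction n) auto

lemma of_int_zsqrt2 [simp]: "rat (of_int n) = n" "irr (of_int n) = 0"
  by (cases n; simp add: of_nat_Suc[symmetric] del: of_nat_Suc)+

lemma numeral_zsqrt2 [simp]: "rat (numeral k) = numeral k" "irr (numeral k) = 0"
  using of_int_zsqrt2[of "numeral k"] by simp_all

definition emb :: "zsqrt2 \<Rightarrow> real" where "emb u = of_int (rat u) + of_int (irr u) * sqrt 2"

definition conj2 :: "zsqrt2 \<Rightarrow> zsqrt2" where "conj2 u = ZS (rat u) (- irr u)"

definition nrm :: "zsqrt2 \<Rightarrow> int" where "nrm u = rat u ^ 2 - 2 * irr u ^ 2"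

lemma emb_simps: "emb 0 = 0" "emb 1 = 1" "emb (u + v) = emb u + emb v" "emb (u - v) = emb u - emb v"
  "emb (- u) = - emb u" "emb (u * v) = emb u * emb v" "emb (of_int n) = of_int n"
  by (simp_all add: emb_def algebra_simps)

lemma emb_power: "emb (u ^ n) = emb u ^ n"
  by (induction n) (simp_all add: emb_simps)

interpretation emb: comm_ring_hom emb
  by unfold_locales (simp_all add: emb_simps)

interpretation conj2: comm_ring_hom conj2
  by unfold_locales (simp_all add: conj2_def zsqrt2_eq_iff)

lemma conj2_conj2 [simp]: "conj2 (conj2 u) = u"
  by (simp add: conj2_def)

lemma conj2_of_int [simp]: "conj2 (of_int n) = of_int n"
  by (simp add: conj2_def zsqrt2_eq_iff)

lemma conj2_power: "conj2 (u ^ n) = conj2 u ^ n"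
  by (induction n) (simp_all add: conj2.hom_mult)

lemma mult_conj2: "u * conj2 u = of_int (nrm u)"
  unfolding zsqrt2_eq_iff rat_simps irr_simps of_int_zsqrt2
  by (simp add: conj2_def nrm_def power2_eq_square)

lemma emb_mult_conj2: "emb u * emb (conj2 u) = of_int (nrm u)"
  by (simp only: emb_simps(6,7)[symmetric] mult_conj2)

lemma nrm_mult: "nrm (u * v) = nrm u * nrm v"
  by (simp add: nrm_def algebra_simps power2_eq_square)

lemma nrm_zero [simp]: "nrm 0 = 0" and nrm_one [simp]: "nrm 1 = 1" and nrm_uminus [simp]: "nrm (- u) = nrm u"
  and nrm_conj2 [simp]: "nrm (conj2 u) = nrm u"
  by (simp_all add: nrm_def conj2_def)

lemma nrm_power: "nrm (u ^ n) = nrm u ^ n"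
  by (induction n) (simp_all add: nrm_mult)

text \<open>The irrationality of \<open>sqrt 2\<close>, by infinite descent on
  \<open>b\<close>.\<close>

lemma square_eq_two_square:
  fixes a b :: nat
  assumes "a ^ 2 = 2 * b ^ 2"
  shows "b = 0"
  using assms
proof (induction b arbitrary: a rule: less_induct)
  case (less b)
  show ?case
  proof (rule ccontr)
    assume "b \<noteq> 0"
    have "even (a ^ 2)" using less.prems by simp
    then obtain c where c: "a = 2 * c" by (auto elim: evenE)
    have b2: "b ^ 2 = 2 * c ^ 2" using less.prems c by (simp add: power2_eq_square)
    then have "even (b ^ 2)" by simp
    then obtain d where d: "b = 2 * d" by (auto elim: evenE)
    have "c ^ 2 = 2 * d ^ 2" using b2 d by (simp add: power2_eq_square)
    then have "d = 0" using less.IH[of d c] d \<open>b \<noteq> 0\<close> by simp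
    then show False using d \<open>b \<noteq> 0\<close> by simp
  qed
qed

lemma nrm_eq_0_iff [simp]: "nrm u = 0 \<longleftrightarrow> u = 0"
proof
  assume "nrm u = 0"
  then have "rat u ^ 2 = 2 * irr u ^ 2" by (simp add: nrm_def)
  then have "int (nat \<bar>rat u\<bar> ^ 2) = int (2 * nat \<bar>irr u\<bar> ^ 2)" by simp
  then have "nat \<bar>rat u\<bar> ^ 2 = 2 * nat \<bar>irr u\<bar> ^ 2" by (simp only: of_nat_eq_iff)
  then have "irr u = 0" using square_eq_two_square by force
  then show "u = 0" using \<open>rat u ^ 2 = _\<close> by (simp add: zsqrt2_eq_iff)
qed (simp add: nrm_def)

lemma emb_eq_0_iff [simp]: "emb u = 0 \<longleftrightarrow> u = 0"
proof
  assume "emb u = 0"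
  then have "real_of_int (nrm u) = 0" using emb_mult_conj2[of u] by simp
  then show "u = 0" by simp
qed (simp add: emb_simps)

instance zsqrt2 :: idom
proof
  fix a b :: zsqrt2
  assume "a \<noteq> 0" "b \<noteq> 0"
  then have "emb (a * b) \<noteq> 0" by (simp add: emb_simps)
  then show "a * b \<noteq> 0" by simp
qed

lemma int_round_quotient:
  fixes a n :: int
  assumes "n \<noteq> 0"
  shows "\<exists>q. 2 * \<bar>a - q * n\<bar> \<le> \<bar>n\<bar>"
proof -
  have "\<bar>of_int (round (real_of_int a / of_int n)) - real_of_int a / of_int n\<bar> \<le> 1 / 2"
    by (rule of_int_round_abs_le)
  then have "\<bar>of_int (round (real_of_int a / of_int n)) - real_of_int a / of_int n\<bar> * \<bar>real_of_int n\<bar> \<le> 1 / 2 * \<bar>real_of_int n\<bar>"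
    by (rule mult_right_mono) simp
  also have "\<bar>of_int (round (real_of_int a / of_int n)) - real_of_int a / of_int n\<bar> * \<bar>real_of_int n\<bar> =
     \<bar>of_int (round (real_of_int a / of_int n)) * of_int n - real_of_int a\<bar>"
    using assms by (simp add: abs_mult[symmetric] left_diff_distrib)
  finally have "real_of_int (2 * \<bar>a - round (real_of_int a / of_int n) * n\<bar>) \<le> of_int \<bar>n\<bar>"
    by (simp add: abs_minus_commute)
  then show ?thesis by (metis of_int_le_iff)
qed

text \<open>Both coordinates of \<open>u / w = u * conj2 w / nrm w\<close> are rounded to nearest
  integers. The errors are at most 1/2, so the remainder has relative norm between -1/2 and
  1/4.\<close>

lemma zsqrt2_euclidean:
  assumes "w \<noteq> 0"
  shows "\<exists>q. \<bar>nrm (u - q * w)\<bar> < \<bar>nrm w\<bar>"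
proof -
  define n where "n = nrm w"
  have n: "n \<noteq> 0" using assms by (simp add: n_def)
  define A where "A = rat (u * conj2 w)"
  define B where "B = irr (u * conj2 w)"
  obtain q1 where q1: "2 * \<bar>A - q1 * n\<bar> \<le> \<bar>n\<bar>" using int_round_quotient[OF n] by blast
  obtain q2 where q2: "2 * \<bar>B - q2 * n\<bar> \<le> \<bar>n\<bar>" using int_round_quotient[OF n] by blast
  let ?q = "ZS q1 q2"
  have "(u - ?q * w) * conj2 w = u * conj2 w - ?q * of_int n"
    by (simp add: left_diff_distrib mult.assoc mult_conj2 n_def)
  then have "rat ((u - ?q * w) * conj2 w) = A - q1 * n" "irr ((u - ?q * w) * conj2 w) = B - q2 * n"
    unfolding A_def B_def by (simp_all only: rat_simps irr_simps of_int_zsqrt2) simp_all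
  then have "nrm ((u - ?q * w) * conj2 w) = (A - q1 * n) ^ 2 - 2 * (B - q2 * n) ^ 2"
    by (simp only: nrm_def)
  then have eq: "nrm (u - ?q * w) * n = (A - q1 * n) ^ 2 - 2 * (B - q2 * n) ^ 2"
    by (simp only: nrm_mult nrm_conj2 n_def)
  have "4 * (A - q1 * n) ^ 2 \<le> n ^ 2"
    using power_mono[OF q1, of 2] by (simp add: power_mult_distrib)
  moreover have "4 * (B - q2 * n) ^ 2 \<le> n ^ 2"
    using power_mono[OF q2, of 2] by (simp add: power_mult_distrib)
  moreover have "0 < n ^ 2" using n by simp
  moreover have "0 \<le> (A - q1 * n) ^ 2" "0 \<le> (B - q2 * n) ^ 2" by simp_all
  ultimately have "\<bar>nrm (u - ?q * w) * n\<bar> < n ^ 2"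
    unfolding eq by linarith
  then have "\<bar>nrm (u - ?q * w)\<bar> * \<bar>n\<bar> < \<bar>n\<bar> * \<bar>n\<bar>"
    by (simp add: abs_mult power2_eq_square)
  then have "\<bar>nrm (u - ?q * w)\<bar> < \<bar>n\<bar>" by (rule mult_right_less_imp_less) simp
  then show ?thesis unfolding n_def by blast
qed

text \<open>A nonzero element of least absolute norm in the ideal generated by \<open>u\<close> and
  \<open>w\<close> divides the whole ideal, by division with remainder.\<close>

lemma zsqrt2_bezout:
  fixes u w :: zsqrt2
  assumes "u \<noteq> 0"
  obtains d s t where "s * u + t * w = d" "d dvd u" "d dvd w" "d \<noteq> 0"
proof -
  define I where "I = {d. d \<noteq> 0 \<and> (\<exists>s t. d = s * u + t * w)}"
  have "u = 1 * u + 0 * w" by simp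
  then have "u \<in> I" unfolding I_def using assms by blast
  then obtain d where d: "d \<in> I" and min: "\<And>d'. d' \<in> I \<Longrightarrow> nat \<bar>nrm d\<bar> \<le> nat \<bar>nrm d'\<bar>"
    using ex_has_least_nat[of "\<lambda>d. d \<in> I" u "\<lambda>d. nat \<bar>nrm d\<bar>"] by auto
  obtain s t where st: "d = s * u + t * w" and d0: "d \<noteq> 0" using d by (auto simp: I_def)
  have dvd: "d dvd z" if "z = a * u + b * w" for z a b
  proof -
    obtain q where q: "\<bar>nrm (z - q * d)\<bar> < \<bar>nrm d\<bar>" using zsqrt2_euclidean[OF d0] by blast
    have "z - q * d = (a - q * s) * u + (b - q * t) * w"
      unfolding that st by (simp add: algebra_simps)
    then have "z - q * d \<in> I \<or> z - q * d = 0" unfolding I_def by blast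
    then have "z - q * d = 0" using min[of "z - q * d"] q by auto
    then have "z = d * q" by (simp add: mult.commute)
    then show ?thesis by (rule dvdI)
  qed
  have "d dvd u" by (rule dvd[of _ 1 0]) simp
  moreover have "d dvd w" by (rule dvd[of _ 0 1]) simp
  ultimately show ?thesis using that st d0 by simp
qed

section \<open>Coprimality as a Bezout identity, and coprime factors of perfect powers\<close>

definition comaximal :: "'a::comm_ring_1 \<Rightarrow> 'a \<Rightarrow> bool" where
  "comaximal a b \<longleftrightarrow> (\<exists>s t. s * a + t * b = 1)"

lemma comaximal_sym: "comaximal a b \<Longrightarrow> comaximal b a"
  unfolding comaximal_def by (subst add.commute) blast

lemma comaximal_mult:
  assumes "comaximal a b" "comaximal a c"
  shows "comaximal a (b * c)"
proof -
  obtain s t s' t' where "s * a + t * b = 1" "s' * a + t' * c = 1"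
    using assms unfolding comaximal_def by blast
  then have "(s * a + t * b) * (s' * a + t' * c) = 1" by simp
  moreover have "(s * a + t * b) * (s' * a + t' * c) = (s * s' * a + s * t' * c + t * b * s') * a + (t * t') * (b * c)"
    by (simp add: algebra_simps)
  ultimately have "(s * s' * a + s * t' * c + t * b * s') * a + (t * t') * (b * c) = 1" by simp
  then show ?thesis unfolding comaximal_def by blast
qed

lemma comaximal_power: "comaximal a b \<Longrightarrow> comaximal a (b ^ n)"
proof (induction n)
  case 0
  have "0 * a + 1 * 1 = 1" by simp
  then show ?case unfolding comaximal_def power_0 by blast
qed (simp add: comaximal_mult)

lemma comaximal_dvd_left:
  assumes "comaximal a b" "d dvd a"
  shows "comaximal d b"
proof -
  obtain s t k where "s * a + t * b = 1" "a = d * k"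
    using assms unfolding comaximal_def dvd_def by blast
  then have "(s * k) * d + t * b = 1" by (simp add: mult_ac)
  then show ?thesis unfolding comaximal_def by blast
qed

lemma comaximal_dvd_mult:
  assumes "comaximal a b" "a dvd c * b"
  shows "a dvd c"
proof -
  obtain s t where "s * a + t * b = 1" using assms(1) unfolding comaximal_def by blast
  then have "c = c * (s * a + t * b)" by simp
  also have "\<dots> = (c * s) * a + t * (c * b)" by (simp add: algebra_simps)
  finally have "c = (c * s) * a + t * (c * b)" .
  moreover have "a dvd (c * s) * a + t * (c * b)"
    by (intro dvd_add dvd_mult assms(2)) simp
  ultimately show ?thesis by simp
qed

text \<open>Prime factorizations are avoided by taking \<open>d\<close> as a greatest common divisor
  of \<open>u\<close> and \<open>w\<close>. With \<open>u = d * u'\<close> and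
  \<open>w = d * w'\<close> one gets \<open>u' * v = d ^ n * w' ^ Suc n\<close>. As
  \<open>u'\<close> is coprime to \<open>w'\<close> and \<open>d\<close> to \<open>v\<close>, the
  elements \<open>u'\<close> and \<open>d ^ n\<close> divide each other and differ by a
  unit.\<close>

lemma comaximal_factor_of_power:
  fixes u v w :: zsqrt2
  assumes "comaximal u v" "u * v = w ^ Suc n" "u \<noteq> 0"
  shows "\<exists>d e e'. u = e * d ^ Suc n \<and> e * e' = 1"
proof -
  obtain d s t where d: "s * u + t * w = d" "d dvd u" "d dvd w" "d \<noteq> 0"
    by (rule zsqrt2_bezout[OF assms(3)])
  then obtain u' w' where u': "u = d * u'" and w': "w = d * w'" by (auto simp: dvd_def)
  have "d * (s * u' + t * w') = d * 1"
    using d(1) unfolding u' w' by (simp add: algebra_simps)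
  then have "s * u' + t * w' = 1" using d(4) by (simp only: mult_cancel_left) auto
  then have "comaximal u' w'" unfolding comaximal_def by blast
  then have c1: "comaximal u' (w' ^ Suc n)" by (rule comaximal_power)
  have "d * (u' * v) = d * (d ^ n * w' ^ Suc n)"
    using assms(2) unfolding u' w' by (simp add: power_mult_distrib mult_ac)
  then have eq: "u' * v = d ^ n * w' ^ Suc n" using d(4) by (simp only: mult_cancel_left) auto
  have "u' dvd d ^ n * w' ^ Suc n" unfolding eq[symmetric] by simp
  then have 1: "u' dvd d ^ n" using c1 by (rule comaximal_dvd_mult[rotated])
  have "comaximal (d ^ n) v"
    by (rule comaximal_sym, rule comaximal_power, rule comaximal_sym, rule comaximal_dvd_left[OF assms(1) d(2)])
  moreover have "d ^ n dvd u' * v" unfolding eq by simp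
  ultimately have 2: "d ^ n dvd u'" by (rule comaximal_dvd_mult)
  obtain k k' where k: "d ^ n = u' * k" "u' = d ^ n * k'" using 1 2 by (auto simp: dvd_def)
  have "u' * (k' * k) = (u' * k) * k'" by (simp add: mult_ac)
  also have "\<dots> = u' * 1" unfolding k(1)[symmetric] k(2)[symmetric] by simp
  finally have "u' * (k' * k) = u' * 1" .
  moreover have "u' \<noteq> 0" using u' assms(3) by auto
  ultimately have "k' * k = 1" by (simp only: mult_cancel_left) auto
  moreover have "u = k' * d ^ Suc n" unfolding u' using k(2) by (simp add: mult_ac)
  ultimately show ?thesis by blast
qed

section \<open>Units of Z[sqrt 2] and the descent\<close>

definition eps :: real where "eps = 1 + sqrt 2"

lemma eps_gt_1: "eps > 1" by (simp add: eps_def)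

lemma inverse_eps: "inverse eps = sqrt 2 - 1"
proof -
  have "eps * (sqrt 2 - 1) = 1" by (simp add: eps_def algebra_simps)
  then show ?thesis by (metis inverse_unique)
qed

definition unit_pow :: "int \<Rightarrow> zsqrt2" where
  "unit_pow k = (if 0 \<le> k then ZS 1 1 ^ nat k else ZS (-1) 1 ^ nat (- k))"

lemma emb_unit_pow: "emb (unit_pow k) = eps powi k"
proof -
  have "emb (ZS 1 1) = eps" "emb (ZS (-1) 1) = inverse eps"
    by (simp_all add: emb_def eps_def inverse_eps[unfolded eps_def])
  then show ?thesis by (simp add: unit_pow_def emb_power power_int_def)
qed

lemma nrm_unit_pow: "\<bar>nrm (unit_pow k)\<bar> = 1"
proof -
  have "nrm (ZS 1 1) = - 1" "nrm (ZS (-1) 1) = - 1" by (simp_all add: nrm_def)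
  then show ?thesis by (simp add: unit_pow_def nrm_power power_abs)
qed

text \<open>Dividing by a power of \<open>eps\<close> moves the unit into the interval from 1
  (included) to \<open>eps\<close> (excluded). Its conjugate then lies between -1 and 1, which
  leaves only coordinates 0 and 1; the norm and the upper bound exclude all but the unit 1.\<close>

lemma unit_eq_unit_pow:
  assumes "\<bar>nrm e\<bar> = 1"
  shows "\<exists>k. \<bar>emb e\<bar> = eps powi k"
proof -
  have e0: "emb e \<noteq> 0" using assms by auto
  define k where "k = \<lfloor>log eps \<bar>emb e\<bar>\<rfloor>"
  have "eps powr k \<le> \<bar>emb e\<bar>" "\<bar>emb e\<bar> < eps powr (k + 1)"
    using e0 eps_gt_1 floor_log_eq_powr_iff[of "\<bar>emb e\<bar>" eps k] by (auto simp: k_def)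
  then have k: "eps powi k \<le> \<bar>emb e\<bar>" "\<bar>emb e\<bar> < eps powi k * eps"
    using eps_gt_1 by (simp_all add: powr_real_of_int' powr_add)
  define f where "f = (if emb e < 0 then - e else e) * unit_pow (- k)"
  have pos: "eps powi k > 0" using eps_gt_1 by simp
  have emb_f: "emb f = \<bar>emb e\<bar> / eps powi k"
    by (simp add: f_def emb_simps emb_unit_pow power_int_minus divide_inverse)
  have f: "1 \<le> emb f" "emb f < eps"
    unfolding emb_f using k pos by (simp_all add: field_simps)
  have nf: "\<bar>nrm f\<bar> = 1"
    unfolding f_def nrm_mult using assms nrm_unit_pow by (simp add: abs_mult)
  have "\<bar>emb f\<bar> * \<bar>emb (conj2 f)\<bar> = 1"
    unfolding abs_mult[symmetric] emb_mult_conj2 using nf by linarith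
  then have "\<bar>emb (conj2 f)\<bar> \<le> 1"
    using f(1) mult_right_mono[of 1 "\<bar>emb f\<bar>" "\<bar>emb (conj2 f)\<bar>"] by simp
  then have c: "-1 \<le> emb (conj2 f)" "emb (conj2 f) \<le> 1" by auto
  have s2: "141/100 < sqrt 2" "sqrt 2 < 142/100"
    by (rule real_less_rsqrt, simp add: power2_eq_square) (rule real_less_lsqrt, simp_all add: power2_eq_square)
  define a where "a = rat f"
  define b where "b = irr f"
  have ab: "emb f = a + b * sqrt 2" "emb (conj2 f) = a - b * sqrt 2"
    by (simp_all add: emb_def conj2_def a_def b_def)
  have "2 * real_of_int a = emb f + emb (conj2 f)" by (simp add: ab)
  moreover have "emb f < 3" using f(2) s2(2) by (simp add: eps_def)
  ultimately have "2 * real_of_int a \<ge> 0" "2 * real_of_int a < 4" using f(1) c by linarith+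
  then have a: "a = 0 \<or> a = 1" by linarith
  have "2 * (real_of_int b * sqrt 2) = emb f - emb (conj2 f)" by (simp add: ab)
  then have bs: "2 * (real_of_int b * sqrt 2) \<ge> 0" "2 * (real_of_int b * sqrt 2) < 2 + sqrt 2"
    using f(1) f(2)[unfolded eps_def] c by linarith+
  have "b < 2"
  proof (rule ccontr)
    assume "\<not> b < 2"
    then have "real_of_int b * sqrt 2 \<ge> 2 * sqrt 2" by (intro mult_right_mono) auto
    then show False using bs s2 by linarith
  qed
  moreover have "b \<ge> 0" using bs(1) by (simp add: zero_le_mult_iff)
  ultimately have b: "b = 0 \<or> b = 1" by linarith
  have "nrm f = a ^ 2 - 2 * b ^ 2" by (simp add: nrm_def a_def b_def)
  then have "a = 1" using nf a b by auto
  moreover have "b = 0"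
  proof (rule ccontr)
    assume "b \<noteq> 0"
    then have "emb f = eps" using b \<open>a = 1\<close> ab by (simp add: eps_def)
    then show False using f by simp
  qed
  ultimately have "emb f = 1" using ab by simp
  then have "\<bar>emb e\<bar> = eps powi k" unfolding emb_f using pos by (simp add: field_simps)
  then show ?thesis by blast
qed

text \<open>The coprime conjugate factors \<open>x + sqrt 2\<close> and \<open>x - sqrt 2\<close>
  have product \<open>y ^ p\<close>, so the first is a unit times a \<open>p\<close>-th power. The
  sign of the unit and the \<open>p\<close>-divisible part of its exponent are absorbed into
  \<open>\<alpha>\<close>.\<close>

lemma lebesgue_nagell_descent:
  fixes x y :: int
  assumes "x ^ 2 - 2 = y ^ p" "odd y" "odd p"
  shows "\<exists>\<alpha> r. 2 * \<bar>r\<bar> < int p \<and> x + sqrt 2 = eps powi r * emb \<alpha> ^ p \<and> \<bar>nrm \<alpha>\<bar> = \<bar>y\<bar>"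
proof -
  obtain n where n: "p = Suc n" using assms(3) by (cases p) auto
  define u where "u = ZS x 1"
  have uv: "u * conj2 u = of_int y ^ p"
  proof -
    have "u * conj2 u = of_int (x ^ 2 - 2)" unfolding mult_conj2 by (simp add: u_def nrm_def)
    then show ?thesis by (simp add: assms(1))
  qed
  have "comaximal u (conj2 u)"
  proof -
    have "coprime (8::int) (y ^ p)"
    proof -
      have "coprime ((2::int) ^ 3) (y ^ p)"
        unfolding coprime_power_left_iff coprime_power_right_iff using assms(2) by simp
      moreover have "(2::int) ^ 3 = 8" by simp
      ultimately show ?thesis by metis
    qed
    then obtain a b where ab: "a * 8 + b * y ^ p = (1::int)"
      by (metis bezout_int coprime_imp_gcd_eq_1)
    \<comment> \<open>The difference of the factors is \<open>2 * sqrt 2\<close>. Its square 8 is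
      coprime to the odd number \<open>y ^ p\<close>, and this yields a Bezout identity for
      \<open>u\<close> and \<open>conj2 u\<close>.\<close>
    have "(u - conj2 u) * (u - conj2 u) = of_int 8"
      by (simp add: u_def zsqrt2_eq_iff conj2_def)
    then have "of_int a * ((u - conj2 u) * (u - conj2 u)) + of_int b * (u * conj2 u) = of_int (a * 8 + b * y ^ p)"
      by (simp add: uv)
    also have "\<dots> = 1" by (simp add: ab)
    finally have "(of_int a * (u - conj2 u)) * u + (of_int b * u - of_int a * (u - conj2 u)) * conj2 u = 1"
      by (simp add: algebra_simps)
    then show ?thesis unfolding comaximal_def by blast
  qed
  moreover have "u \<noteq> 0" by (simp add: u_def zsqrt2_eq_iff)
  ultimately obtain d e e' where de: "u = e * d ^ p" "e * e' = 1"
    using comaximal_factor_of_power[of u "conj2 u" "of_int y" n] uv n by blast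
  have "nrm e * nrm e' = 1" using arg_cong[OF de(2), of nrm] by (simp add: nrm_mult)
  then have ne: "\<bar>nrm e\<bar> = 1" by (auto simp: zmult_eq_1_iff)
  then obtain k where k: "\<bar>emb e\<bar> = eps powi k" using unit_eq_unit_pow by blast
  \<comment> \<open>\<open>t\<close> is an integer nearest to \<open>k / p\<close>, which makes
    \<open>r\<close> the least absolute residue of \<open>k\<close>; oddness of \<open>p\<close>
    then makes the bound strict.\<close>
  obtain t where t: "2 * \<bar>k - t * int p\<bar> \<le> \<bar>int p\<bar>" using int_round_quotient[of "int p" k] n by auto
  define r where "r = k - t * int p"
  have "2 * \<bar>r\<bar> \<noteq> int p" using assms(3) by presburger
  then have r: "2 * \<bar>r\<bar> < int p" using t by (simp add: r_def)
  define \<alpha> where "\<alpha> = (if emb e < 0 then - 1 else 1) * unit_pow t * d"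
  have "eps powi r * emb \<alpha> ^ p = (if emb e < 0 then - 1 else 1) ^ p * (eps powi r * (eps powi t) ^ p) * emb d ^ p"
    by (simp add: \<alpha>_def emb_simps emb_unit_pow power_mult_distrib mult_ac)
  also have "eps powi r * (eps powi t) ^ p = eps powi k"
    using eps_gt_1 by (simp add: r_def power_int_mult[symmetric] power_int_add[symmetric] flip: power_int_of_nat)
  also have "(if emb e < 0 then - 1 else 1) ^ p * eps powi k = emb e"
    using assms(3) by (simp add: k[symmetric])
  also have "emb e * emb d ^ p = emb u" by (simp add: de(1) emb_simps emb_power)
  also have "emb u = x + sqrt 2" by (simp add: u_def emb_def)
  finally have eq: "x + sqrt 2 = eps powi r * emb \<alpha> ^ p" by simp
  have "\<bar>nrm d\<bar> ^ p = \<bar>nrm u\<bar>"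
    using ne unfolding de(1) by (simp add: nrm_mult nrm_power abs_mult power_abs)
  also have "nrm u = y ^ p" using assms(1) by (simp add: u_def nrm_def)
  finally have "\<bar>nrm d\<bar> ^ p = \<bar>y\<bar> ^ p" by (simp add: power_abs)
  then have "\<bar>nrm d\<bar> = \<bar>y\<bar>" using n power_eq_iff_eq_base[of p "\<bar>nrm d\<bar>" "\<bar>y\<bar>"] by simp
  then have "\<bar>nrm \<alpha>\<bar> = \<bar>y\<bar>"
    unfolding \<alpha>_def nrm_mult by (simp add: abs_mult nrm_unit_pow)
  then show ?thesis using r eq by blast
qed

section \<open>Choice of parameters\<close>

lemma ln_fact_ge: "real n * ln n - n + 1 \<le> ln (fact n)" if "n \<ge> 1"
  using that
proof (induction n rule: nat_induct_at_least)
  case (Suc n)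
  have "real n * (ln (Suc n) - ln n) \<le> 1"
  proof -
    have "ln (real (Suc n)) - ln n = ln (1 + 1 / n)"
      using Suc.hyps by (simp add: ln_divide_pos[symmetric] add_divide_distrib add.commute)
    also have "\<dots> \<le> 1 / n" by (rule ln_add_one_self_le_self) simp
    finally show ?thesis using Suc.hyps by (simp add: field_simps)
  qed
  moreover have "ln (fact (Suc n)) = ln (real (Suc n)) + ln (fact n)"
    using Suc.hyps by (simp add: ln_mult)
  ultimately show ?case using Suc.IH by (simp add: algebra_simps)
qed simp

text \<open>This is the gain from the factorials in the denominators of the binomial columns. Of the
  constant 3/2, the part 1 comes from the weak Stirling bound and 1/2 from summing
  \<open>k * ln k\<close>.\<close>

lemma sum_ln_fact_ge: "real K * (real K - 1) / 2 * (ln K - 3/2) \<le> (\<Sum>k<K. ln (fact k))" if "K \<ge> 1"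
  using that
proof (induction K rule: nat_induct_at_least)
  case (Suc K)
  have "ln (real (Suc K)) - ln K = ln (1 + 1 / K)"
    using Suc.hyps by (simp add: ln_divide_pos[symmetric] add_divide_distrib add.commute)
  also have "\<dots> \<le> 1 / K" by (rule ln_add_one_self_le_self) simp
  finally have "real K * (K + 1) / 2 * (ln (Suc K) - ln K) \<le> real K * (K + 1) / 2 * (1 / K)"
    by (intro mult_left_mono) auto
  also have "\<dots> = (K + 1) / 2" using Suc.hyps by simp
  finally have 1: "real K * (K + 1) / 2 * (ln (Suc K) - ln K) \<le> (K + 1) / 2" .
  have "real (Suc K) * (real (Suc K) - 1) / 2 * (ln (Suc K) - 3/2) =
     real K * (K + 1) / 2 * (ln (Suc K) - ln K) + real K * (real K - 1) / 2 * (ln K - 3/2) + K * ln K - 3/2 * K"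
    by (simp add: field_simps)
  also have "\<dots> \<le> (K + 1) / 2 + real K * (real K - 1) / 2 * (ln K - 3/2) + K * ln K - 3/2 * K"
    using 1 by linarith
  also have "\<dots> \<le> real K * (real K - 1) / 2 * (ln K - 3/2) + (real K * ln K - K + 1)"
    by (simp add: field_simps)
  also have "\<dots> \<le> (\<Sum>k<K. ln (fact k)) + ln (fact K)"
    using Suc.IH ln_fact_ge[OF Suc.hyps] by linarith
  finally show ?case by simp
qed simp

lemma ln_16_bounds: "8/3 \<le> ln (16::real)" "ln (16::real) \<le> 25/9"
proof -
  have "ln (16::real) = ln (2 ^ 4)" by simp
  also have "\<dots> = 4 * ln 2" by (subst ln_realpow) auto
  finally show "8/3 \<le> ln (16::real)" "ln (16::real) \<le> 25/9"
    using ln2_ge_two_thirds ln2_le_25_over_36 by auto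
qed

lemma ln_7_ge: "13/7 \<le> ln (7::real)"
proof -
  have "ln (8::real) = ln (2 ^ 3)" by simp
  also have "\<dots> = 3 * ln 2" by (subst ln_realpow) auto
  finally have "2 \<le> ln (8::real)" using ln2_ge_two_thirds by linarith
  moreover have "ln (8/7::real) \<le> 8/7 - 1" by (rule ln_le_minus_one) simp
  moreover have "ln (8/7::real) = ln 8 - ln 7" by (rule ln_divide_pos) auto
  ultimately show ?thesis by linarith
qed

lemma ln_eps_bounds: "2 * ln eps \<le> (1771/1000)" "1 \<le> 2 * ln eps"
proof -
  have pos: "eps > 0" unfolding eps_def by (simp add: add_pos_pos)
  have s2: "sqrt 2 < 142/100" "141/100 < sqrt 2"
    by (rule real_less_lsqrt, simp, simp add: power2_eq_square, rule real_less_rsqrt, simp add: power2_eq_square)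
  have "eps ^ 4 = 17 + 12 * sqrt 2"
    by (simp add: eps_def power4_eq_xxxx algebra_simps)
  also have "\<dots> \<le> (341/10)" using s2(1) by simp
  finally have "ln (eps ^ 4) \<le> ln (341/10)" using pos by simp
  then have 1: "4 * ln eps \<le> ln (341/10)" by (simp add: ln_realpow pos)
  \<comment> \<open>The power 10 turns the comparison of 34.1 with \<open>2 powr 5.1\<close> into
    one between rational numbers.\<close>
  have "ln ((341/10::real) ^ 10) \<le> ln (2 ^ 51)" by (subst ln_le_cancel_iff) (simp_all add: power_divide)
  then have "10 * ln (341/10::real) \<le> 51 * ln 2" by (simp only: ln_realpow of_nat_numeral)
  then show "2 * ln eps \<le> (1771/1000)" using 1 ln2_le_25_over_36 by simp
  have "ln 2 \<le> ln eps" using s2(2) by (simp add: eps_def)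
  then show "1 \<le> 2 * ln eps" using ln2_ge_two_thirds by linarith
qed

text \<open>The budget of the contradiction, measured in units of the analytic gain
  \<open>G\<close>: combinatorial factors take 2 percent (P1), the binomials 45.3 (P2), the growth
  of the exponentials 22.4 (P3) and the denominators \<open>y\<close> 25.3 (P4). The total is 95
  percent. Here \<open>L\<close> is of order \<open>sqrt (p / 18.6)\<close>, and
  \<open>4 * L - 1\<close> is the bound \<open>8 * h + 3\<close> on the second coordinates of the
  nodes.\<close>

lemma parameter_inequality:
  fixes L m h K N :: nat and p u B X :: real
  assumes L: "L = 2 * h + 1" "h \<ge> 3" and m: "m \<ge> 6" and K: "K = 7 * m" and N: "N = K * L"
    and p: "(93/5) * real L ^ 2 \<le> p" "p \<le> (93/5) * (real L + 2) ^ 2" "912 \<le> p"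
    and u: "p * u \<le> 14 * real L * (real m + 1) * ln 16"
    and B: "B = (real m + 1) * p / 2 * (257/32) + K"
    and X: "X = 2 * ln eps * (real m + 1) / 2 * (257/32)"
  shows "ln (fact N) + N * ln 4 + L * (\<Sum>k<K. k * ln B - ln (fact k)) +
     K * (real h * (real h + 1)) * (X + (4 * real L - 1) * u) < ln 16 * (real N * (real N - 1) / 2)"
proof -
  define M where "M = real m"
  define l where "l = real L"
  define n where "n = real N"
  define lam where "lam = ln (16::real)"
  have M: "M \<ge> 6" using m by (simp add: M_def)
  have l: "l \<ge> 7" using L by (simp add: l_def)
  have l2: "l ^ 2 \<ge> 1" using l by (simp add: one_le_power)
  have n: "n = 7 * M * l" by (simp add: n_def N K M_def l_def)
  have n294: "n \<ge> 294"
  proof -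
    have "6 * 7 \<le> M * l" using M l by (intro mult_mono) auto
    then show ?thesis by (simp add: n)
  qed
  have lam: "8/3 \<le> lam" "lam \<le> 25/9" using ln_16_bounds by (auto simp: lam_def)
  define G where "G = lam * (n * (n - 1) / 2)"
  have Gpos: "G > 0" unfolding G_def using n294 lam by simp
  \<comment> \<open>The lower bound 294 is 7 * 6 * 7, from \<open>m \<ge> 6\<close> and
    \<open>L \<ge> 7\<close>.\<close>
  have "n * (293/294 * n) \<le> n * (n - 1)"
    using n294 by (intro mult_left_mono) auto
  then have nn1: "293/294 * (n * n) \<le> n * (n - 1)" by (simp add: mult_ac)
  have Glow: "lam * (293/294 * (n * n) / 2) \<le> G"
    unfolding G_def using lam by (intro mult_left_mono divide_right_mono nn1) auto
  have hh: "real h * (real h + 1) = (l ^ 2 - 1) / 4"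
    by (simp add: l_def L power2_eq_square algebra_simps)

  have P1: "ln (fact N) + N * ln 4 \<le> (1/50) * G"
  proof -
    have "ln (fact N) \<le> ln (real N ^ N)"
    proof -
      have "fact N \<le> real (N ^ N)" by (rule fact_le_power)
      then show ?thesis using n294 by (simp add: n_def)
    qed
    also have "\<dots> = n * ln n" using n294 by (simp add: n_def ln_realpow)
    finally have "ln (fact N) + N * ln 4 \<le> n * (ln n + ln 4)" by (simp add: n_def algebra_simps)
    also have "ln n + ln 4 = ln (1176 * (n / 294))" using n294 by (simp add: ln_mult_pos[symmetric])
    also have "\<dots> = ln 1176 + ln (n / 294)" using n294 by (subst ln_mult) auto
    also have "\<dots> \<le> (764/100) + (n / 294 - 1)"
    proof (rule add_mono)
      have "ln (1176::real) \<le> ln (2 ^ 11)" by simp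
      also have "\<dots> = 11 * ln 2" by (subst ln_realpow) auto
      finally show "ln (1176::real) \<le> (764/100)" using ln2_le_25_over_36 by simp
      show "ln (n / 294) \<le> n / 294 - 1" using n294 by (intro ln_le_minus_one) auto
    qed
    also have "\<dots> \<le> (1/50) * (8/3 * ((n - 1) / 2))" using n294 by simp
    also have "\<dots> \<le> (1/50) * (lam * ((n - 1) / 2))" using lam n294 by (intro mult_left_mono mult_right_mono) auto
    finally show ?thesis using n294 by (simp add: G_def mult_ac)
  qed

  have P2: "L * (\<Sum>k<K. k * ln B - ln (fact k)) \<le> (453/1000) * G"
  proof -
    have K1: "K \<ge> 1" using m K by simp
    have Kr: "real K = 7 * M" by (simp add: K M_def)
    have Bpos: "B > 0" unfolding B using p K1 by (intro add_nonneg_pos) auto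
    have BK: "B / K \<le> (671/1000) * p"
    proof -
      have "B / K = (M + 1) / M * p * (257/448) + 1"
        unfolding B Kr using M by (simp add: M_def[symmetric] field_simps)
      also have "(M + 1) / M \<le> 7/6" using M by (simp add: field_simps)
      then have "(M + 1) / M * p * (257/448) + 1 \<le> 7/6 * p * (257/448) + 1"
        using p by (intro add_mono mult_right_mono) auto
      also have "\<dots> \<le> (671/1000) * p" using p(3) by simp
      finally show ?thesis .
    qed
    have "(l + 2) \<le> 9/7 * l" using l by simp
    then have "(l + 2) ^ 2 \<le> (9/7 * l) ^ 2" using l by (intro power_mono) auto
    then have "49 * (l + 2) ^ 2 \<le> 81 * l ^ 2" by (simp add: power_mult_distrib power_divide)
    moreover have "5 * p \<le> 93 * (l + 2) ^ 2" using p(2) by (simp add: l_def)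
    ultimately have "4 * p \<le> 123 * l ^ 2" using zero_le_power2[of l] by linarith
    moreover have "1000 * (B / K) \<le> 671 * p" using BK by linarith
    ultimately have "49 * (B / K) \<le> 1024 * l ^ 2" using zero_le_power2[of l] by linarith
    \<comment> \<open>This form allows the tangent bound for the logarithm at \<open>l = 7\<close>,
      where the estimate for \<open>lnBK\<close> is nearly sharp. The bound is linear in
      \<open>l\<close>, matching the factor \<open>l\<close> in the share of
      \<open>G\<close>.\<close>
    then have "B / K \<le> 2 ^ 10 * (l / 7) ^ 2" by (simp add: power_divide mult.commute)
    then have "ln (B / K) \<le> ln (2 ^ 10 * (l / 7) ^ 2)" using Bpos K1 l by simp
    also have "\<dots> = ln (2 ^ 10) + ln ((l / 7) ^ 2)" using l by (intro ln_mult_pos) auto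
    also have "\<dots> = 10 * ln 2 + 2 * ln (l / 7)" by (simp only: ln_realpow of_nat_numeral)
    also have "\<dots> \<le> 10 * (25/36) + 2 * (l / 7 - 1)"
      using ln2_le_25_over_36 ln_le_minus_one[of "l / 7"] l by simp
    finally have lnBK: "ln B - ln K + 3/2 \<le> (453/1000) * (8/3) * l" using l Bpos K1 by (simp add: ln_div)
    have "(\<Sum>k<K. k * ln B - ln (fact k)) = (\<Sum>k<K. real k) * ln B - (\<Sum>k<K. ln (fact k))"
      by (simp add: sum_subtractf sum_distrib_right)
    also have "(\<Sum>k<K. real k) = real K * (real K - 1) / 2"
      using K1 by (induction K rule: nat_induct_at_least) (auto simp: field_simps)
    also have "real K * (real K - 1) / 2 * ln B - (\<Sum>k<K. ln (fact k)) \<le> real K * (real K - 1) / 2 * (ln B - ln K + 3/2)"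
    proof -
      define c where "c = real K * (real K - 1) / 2"
      have "c * (ln K - 3/2) \<le> (\<Sum>k<K. ln (fact k))" unfolding c_def by (rule sum_ln_fact_ge[OF K1])
      then show ?thesis unfolding c_def[symmetric] by (simp add: algebra_simps)
    qed
    also have "\<dots> \<le> real K * (real K - 1) / 2 * ((453/1000) * lam * l)"
    proof (rule mult_left_mono)
      have "(453/1000) * (8/3) * l \<le> (453/1000) * lam * l"
        using lam l by (intro mult_right_mono mult_left_mono) auto
      then show "ln B - ln K + 3/2 \<le> (453/1000) * lam * l" using lnBK by linarith
    qed (use K1 in auto)
    finally have "L * (\<Sum>k<K. k * ln B - ln (fact k)) \<le> L * (real K * (real K - 1) / 2 * ((453/1000) * lam * l))"
      by (intro mult_left_mono) auto
    also have "\<dots> = (453/1000) * (lam * ((real K * l) * (l * (real K - 1)) / 2))"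
      by (simp add: l_def)
    also have "\<dots> \<le> (453/1000) * (lam * ((real K * l) * (n - 1) / 2))"
    proof -
      have "l * (real K - 1) \<le> n - 1" using l by (simp add: n_def N l_def algebra_simps)
      then show ?thesis using lam l K1 by (intro mult_left_mono divide_right_mono) auto
    qed
    also have "real K * l = n" by (simp add: n_def N l_def)
    finally show ?thesis by (simp add: G_def)
  qed

  have P3: "K * (real h * (real h + 1)) * X \<le> (224/1000) * G"
  proof -
    have "K * (real h * (real h + 1)) * X = 7 * M * ((l ^ 2 - 1) / 4) * (2 * ln eps * (M + 1) / 2 * (257/32))"
      unfolding hh X by (simp add: K M_def)
    also have "\<dots> \<le> 7 * M * (l ^ 2 / 4) * ((1771/1000) * (7/6 * M) / 2 * (257/32))"
      using M l2 ln_eps_bounds by (intro mult_mono divide_right_mono) auto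
    also have "\<dots> = (7 * (1771/1000) * 7 * 257 / (4 * 6 * 2 * 32 * 49)) * (n * n)"
      by (simp add: n power2_eq_square)
    also have "\<dots> \<le> (224/1000) * (8/3 * ((293/294) * (n * n) / 2))"
      by simp
    also have "\<dots> \<le> (224/1000) * (lam * ((293/294) * (n * n) / 2))"
      using lam by (intro mult_left_mono mult_right_mono) auto
    also have "\<dots> \<le> (224/1000) * G" using Glow by simp
    finally show ?thesis .
  qed

  have P4: "K * (real h * (real h + 1)) * ((4 * l - 1) * u) \<le> (253/1000) * G"
  proof -
    have ppos: "p > 0" using p by simp
    \<comment> \<open>Since \<open>p\<close> is at least \<open>18.6 * l ^ 2\<close>,
      \<open>u\<close> is at most a multiple of \<open>M * lam / l\<close>. The whole term is then
      of order \<open>lam * M ^ 2 * l ^ 2\<close>, that is, \<open>lam * n ^ 2\<close>.\<close>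
    have "u \<le> 14 * l * (M + 1) * lam / p"
      using u ppos by (simp add: l_def M_def lam_def field_simps)
    also have "\<dots> \<le> 14 * l * (7/6 * M) * lam / p"
      using M l lam ppos by (intro divide_right_mono mult_right_mono mult_left_mono) auto
    also have "\<dots> \<le> 14 * l * (7/6 * M) * lam / ((93/5) * l ^ 2)"
      using M l lam p(1) ppos by (intro divide_left_mono) (auto simp: l_def[symmetric])
    also have "\<dots> = 14 * 7 / (6 * (93/5)) * (M * lam / l)"
      using l by (simp add: power2_eq_square field_simps)
    finally have ub: "u \<le> 14 * 7 / (6 * (93/5)) * (M * lam / l)" .
    have "K * (real h * (real h + 1)) * ((4 * l - 1) * u) = 7 * M * ((l ^ 2 - 1) / 4) * (4 * l - 1) * u"
      unfolding hh by (simp add: K M_def)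
    also have "\<dots> \<le> 7 * M * ((l ^ 2 - 1) / 4) * (4 * l - 1) * (14 * 7 / (6 * (93/5)) * (M * lam / l))"
      using M l l2 ub by (intro mult_left_mono mult_nonneg_nonneg) auto
    also have "\<dots> \<le> 7 * M * (l ^ 2 / 4) * (4 * l) * (14 * 7 / (6 * (93/5)) * (M * lam / l))"
      using M l l2 lam by (intro mult_right_mono mult_mono) auto
    also have "\<dots> = (7 * 14 * 7 / (6 * (93/5) * 49)) * (lam * (n * n))"
      using l by (simp add: n power2_eq_square field_simps)
    also have "\<dots> \<le> (253/1000) * (lam * ((293/294) * (n * n) / 2))"
      using lam n294 by simp
    also have "\<dots> \<le> (253/1000) * G" using Glow by simp
    finally show ?thesis .
  qed
  have "ln (fact N) + N * ln 4 + L * (\<Sum>k<K. k * ln B - ln (fact k)) +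
     K * (real h * (real h + 1)) * (X + (4 * real L - 1) * u) \<le> (95/100) * G"
    using P1 P2 P3 P4 unfolding l_def[symmetric] distrib_left by simp
  also have "\<dots> < G" using Gpos by simp
  also have "G = ln 16 * (real N * (real N - 1) / 2)"
    using n294 by (simp add: G_def n_def lam_def)
  finally show ?thesis .
qed

section \<open>The interpolation determinant\<close>

text \<open>For fixed \<open>s\<close> the positions \<open>r * p - s * r0\<close> are spaced by
  \<open>p\<close>, so a window of length \<open>R * p\<close> holds \<open>R\<close> consecutive
  values of \<open>r\<close>.\<close>

lemma node_set_exists:
  fixes p r0 :: int and \<sigma> R :: nat
  assumes "p > 0"
  shows "\<exists>E :: (int \<times> int) set. finite E \<and> card E = (2 * \<sigma> + 1) * R \<and>
     (\<forall>(r, s)\<in>E. \<bar>s\<bar> \<le> int \<sigma> \<and> 2 * \<bar>r * p - s * r0\<bar> \<le> int R * p)"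
proof -
  \<comment> \<open>The least \<open>r\<close> with \<open>r * p - s * r0 \<ge> - R * p / 2\<close>;
    the ceiling is written as a negated floor.\<close>
  define c where "c s = - ((int R * p - 2 * s * r0) div (2 * p))" for s
  define D where "D = {- int \<sigma>..int \<sigma>} \<times> {0..<int R}"
  define E where "E = (\<lambda>(s, i). (c s + i, s)) ` D"
  have inj: "inj_on (\<lambda>(s, i). (c s + i, s)) D" by (auto simp: inj_on_def)
  have "card E = (2 * \<sigma> + 1) * R"
    unfolding E_def card_image[OF inj] by (simp add: D_def card_cartesian_product nat_add_distrib nat_mult_distrib)
  moreover have "finite E" unfolding E_def D_def by simp
  moreover have "\<bar>s\<bar> \<le> int \<sigma> \<and> 2 * \<bar>r * p - s * r0\<bar> \<le> int R * p" if rs: "(r, s) \<in> E" for r s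
  proof -
    obtain i where i: "r = c s + i" "0 \<le> i" "i < int R" "\<bar>s\<bar> \<le> int \<sigma>"
      using rs by (auto simp: E_def D_def)
    define q where "q = (int R * p - 2 * s * r0) div (2 * p)"
    have q: "q * (2 * p) + (int R * p - 2 * s * r0) mod (2 * p) = int R * p - 2 * s * r0"
      unfolding q_def by (rule div_mult_mod_eq)
    have m: "0 \<le> (int R * p - 2 * s * r0) mod (2 * p)" "(int R * p - 2 * s * r0) mod (2 * p) < 2 * p"
      using assms by auto
    have "0 * p \<le> i * p" "i * p \<le> (int R - 1) * p" using i assms by (auto intro: mult_right_mono)
    moreover have "r = i - q" using i(1) by (simp add: c_def q_def)
    then have "r * p = i * p - q * p" by (simp add: left_diff_distrib)
    ultimately have "2 * (r * p - s * r0) \<le> int R * p" "- (int R * p) \<le> 2 * (r * p - s * r0)"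
      using q m by (simp_all add: algebra_simps)
    then show ?thesis using i(4) by linarith
  qed
  ultimately show ?thesis by (intro exI[of _ E]) auto
qed

text \<open>The prime \<open>p\<close> divides \<open>(s - s') * r0\<close> but not
  \<open>r0\<close>, so it divides \<open>s - s'\<close>, which is smaller than \<open>p\<close> in
  absolute value.\<close>

lemma node_position_inj:
  fixes p r0 r r' s s' :: int
  assumes "prime p" "r0 \<noteq> 0" "\<bar>r0\<bar> < p" "\<bar>s - s'\<bar> < p" "r * p - s * r0 = r' * p - s' * r0"
  shows "r = r' \<and> s = s'"
proof -
  have eq: "(s - s') * r0 = p * (r - r')" using assms(5) by (simp add: algebra_simps)
  then have "p dvd (s - s') * r0" by simp
  then have "p dvd s - s' \<or> p dvd r0" using assms(1) by (simp add: prime_dvd_mult_iff)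
  moreover have "\<not> p dvd r0" using assms(2,3) dvd_imp_le_int[of r0 p] by auto
  ultimately have "s - s' = 0" using assms(4) dvd_imp_le_int[of "s - s'" p] by auto
  moreover have "p \<noteq> 0" using assms(1) by auto
  ultimately show ?thesis using eq by auto
qed

text \<open>Since conjugation permutes the columns, the determinant equals its conjugate up to sign.
  The square of its absolute value is therefore the absolute value of its norm, a nonzero
  integer.\<close>

lemma abs_emb_det_ge_1:
  assumes \<pi>: "\<pi> permutes {..<N}"
    and conj: "\<And>i j. i < N \<Longrightarrow> j < N \<Longrightarrow> conj2 (q j i) = q j (\<pi> i)"
    and nz: "det (mat N N (\<lambda>(j,i). q j i)) \<noteq> 0"
  shows "1 \<le> \<bar>emb (det (mat N N (\<lambda>(j,i). q j i)))\<bar>"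
proof -
  let ?Q = "mat N N (\<lambda>(j,i). q j i)" and ?T = "mat N N (\<lambda>(i,j). q j i)"
  have \<pi>_lt: "\<pi> i < N" if "i < N" for i using permutes_in_image[OF \<pi>, of i] that by auto
  have T: "?T = transpose_mat ?Q" by (rule eq_matI) auto
  have "conj2 (det ?T) = det (map_mat conj2 ?T)" by (rule conj2.hom_det[symmetric])
  also have "map_mat conj2 ?T = mat N N (\<lambda>(i,j). ?T $$ (\<pi> i, j))"
    by (rule eq_matI) (auto simp: conj \<pi>_lt)
  also have "det \<dots> = signof \<pi> * det ?T"
    by (rule det_permute_rows) (use \<pi> in \<open>auto simp: atLeast0LessThan\<close>)
  also have "det ?T = det ?Q" unfolding T by (rule det_transpose[of _ N]) auto
  finally have cd: "conj2 (det ?Q) = signof \<pi> * det ?Q" .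
  have "\<bar>emb (conj2 (det ?Q))\<bar> = \<bar>emb (det ?Q)\<bar>"
    unfolding cd by (simp add: sign_def emb_simps)
  then have "\<bar>emb (det ?Q)\<bar> * \<bar>emb (det ?Q)\<bar> = \<bar>of_int (nrm (det ?Q))\<bar>"
    by (simp only: emb_mult_conj2[symmetric] abs_mult)
  moreover have "1 \<le> \<bar>real_of_int (nrm (det ?Q))\<bar>"
  proof -
    have "nrm (det ?Q) \<noteq> 0" using nz by simp
    then have "1 \<le> \<bar>nrm (det ?Q)\<bar>" by linarith
    then show ?thesis by linarith
  qed
  ultimately have "1 \<le> \<bar>emb (det ?Q)\<bar> ^ 2" by (simp add: power2_eq_square)
  then have "1 ^ 2 \<le> \<bar>emb (det ?Q)\<bar> ^ 2" by simp
  then show ?thesis by (rule power2_le_imp_le) simp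
qed

text \<open>\<open>ZS 3 2\<close> is the square of \<open>eps\<close> and has norm 1, so its inverse
  is its conjugate \<open>ZS 3 (-2)\<close>; negative powers stay in the ring.\<close>

definition eps2_pow :: "int \<Rightarrow> zsqrt2" where
  "eps2_pow n = (if 0 \<le> n then ZS 3 2 ^ nat n else ZS 3 (-2) ^ nat (- n))"

lemma conj2_eps2_pow: "conj2 (eps2_pow n) = eps2_pow (- n)"
proof -
  have "conj2 (ZS 3 2) = ZS 3 (-2)" "conj2 (ZS 3 (-2)) = ZS 3 2" by (simp_all add: conj2_def)
  then show ?thesis by (cases "n = 0") (auto simp: eps2_pow_def conj2_power)
qed

lemma emb_eps2_pow: "emb (eps2_pow n) = exp (2 * ln eps * n)"
proof -
  have "eps > 0" using eps_gt_1 by simp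
  then have e: "exp (2 * ln eps) = eps ^ 2" by (simp add: exp_double)
  have "emb (ZS 3 2) = eps ^ 2" by (simp add: emb_def eps_def power2_eq_square algebra_simps)
  then have 1: "emb (ZS 3 2) = exp (2 * ln eps)" using e by simp
  have "emb (ZS 3 2) * emb (ZS 3 (-2)) = 1"
    by (simp add: emb_def algebra_simps)
  then have 2: "emb (ZS 3 (-2)) = exp (- (2 * ln eps))" using 1 by (simp add: exp_minus field_simps)
  show ?thesis
    unfolding eps2_pow_def emb_power 1 2 exp_of_nat_mult[symmetric]
    by (simp add: emb_power 1 2 exp_of_nat_mult[symmetric] mult.commute)
qed

text \<open>For \<open>|n| \<le> M\<close> this is \<open>y ^ M * g ^ n\<close> with
  \<open>g = \<alpha> ^ 2 / y\<close>, the power of \<open>y\<close> clearing the denominator. The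
  conjugate of \<open>g\<close> is \<open>1 / g\<close>, hence \<open>conj2 \<alpha>\<close> for
  negative \<open>n\<close>.\<close>

definition scaled_pow :: "zsqrt2 \<Rightarrow> int \<Rightarrow> nat \<Rightarrow> int \<Rightarrow> zsqrt2" where
  "scaled_pow \<alpha> y M n = (if 0 \<le> n then (\<alpha> ^ 2) ^ nat n * of_int y ^ (M - nat n)
     else (conj2 \<alpha> ^ 2) ^ nat (- n) * of_int y ^ (M - nat (- n)))"

lemma conj2_scaled_pow: "conj2 (scaled_pow \<alpha> y M n) = scaled_pow \<alpha> y M (- n)"
  by (cases "n = 0") (auto simp: scaled_pow_def conj2_power conj2.hom_mult)

lemma emb_scaled_pow:
  assumes "\<bar>nrm \<alpha>\<bar> = y" "y > 0" "\<bar>n\<bar> \<le> int M"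
  shows "emb (scaled_pow \<alpha> y M n) = of_int y ^ M * exp (n * ln (emb \<alpha> ^ 2 / y))"
proof -
  define g where "g = emb \<alpha> ^ 2 / y"
  have "\<alpha> \<noteq> 0" using assms(1,2) by auto
  then have g0: "g > 0" using assms(2) by (simp add: g_def)
  have g1: "emb \<alpha> ^ 2 = y * exp (ln g)" using g0 assms(2) by (simp add: g_def)
  have "(emb \<alpha> * emb (conj2 \<alpha>)) ^ 2 = real_of_int y ^ 2"
  proof -
    have "nrm \<alpha> ^ 2 = y ^ 2" unfolding assms(1)[symmetric] by simp
    then show ?thesis unfolding emb_mult_conj2 by (simp only: of_int_power[symmetric])
  qed
  then have "emb (conj2 \<alpha>) ^ 2 = y ^ 2 / emb \<alpha> ^ 2"
    using \<open>\<alpha> \<noteq> 0\<close> by (simp add: power_mult_distrib field_simps)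
  also have "\<dots> = y * exp (- ln g)"
    unfolding g1 using assms(2) by (simp add: exp_minus power2_eq_square field_simps)
  finally have g2: "emb (conj2 \<alpha>) ^ 2 = y * exp (- ln g)" .
  show ?thesis
  proof (cases "0 \<le> n")
    case True
    then have M: "M = nat n + (M - nat n)" using assms(3) by linarith
    have "emb (scaled_pow \<alpha> y M n) = (y * exp (ln g)) ^ nat n * real_of_int y ^ (M - nat n)"
      using True by (simp add: scaled_pow_def emb_simps emb_power g1)
    also have "\<dots> = real_of_int y ^ (nat n + (M - nat n)) * exp (real (nat n) * ln g)"
      by (subst exp_of_nat_mult) (simp add: power_mult_distrib power_add)
    finally show ?thesis using M True unfolding g_def[symmetric] by simp
  next
    case False
    then have M: "M = nat (- n) + (M - nat (- n))" using assms(3) by linarith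
    have "emb (scaled_pow \<alpha> y M n) = (y * exp (- ln g)) ^ nat (- n) * real_of_int y ^ (M - nat (- n))"
      using False by (simp add: scaled_pow_def emb_simps emb_power g2)
    also have "\<dots> = real_of_int y ^ (nat (- n) + (M - nat (- n))) * exp (real (nat (- n)) * (- ln g))"
      by (subst exp_of_nat_mult) (simp add: power_mult_distrib power_add)
    finally show ?thesis using M False unfolding g_def[symmetric] by simp
  qed
qed

lemma abs_exp_minus_1_le: "\<bar>exp t - 1\<bar> \<le> 2 * \<bar>t\<bar>" if "\<bar>t\<bar> \<le> 1" for t :: real
proof (cases "t \<ge> 0")
  case True
  have "exp t \<le> 1 + t + t ^ 2" using True that by (intro exp_bound) auto
  moreover have "t * t \<le> t * 1" using True that by (intro mult_left_mono) auto
  ultimately show ?thesis using True by (simp add: power2_eq_square)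
next
  case False
  then have "exp t < 1" by simp
  then show ?thesis using exp_ge_add_one_self[of t] False by linarith
qed

lemma sum_abs_centered: "(\<Sum>l<2 * h + 1. \<bar>real l - real h\<bar>) = real h * (real h + 1)"
proof (induction h)
  case (Suc h)
  define n where "n = 2 * h + 1"
  define f where "f l = \<bar>real l - real (Suc h)\<bar>" for l
  have "(\<Sum>l<2 * Suc h + 1. f l) = (\<Sum>l<Suc (Suc n). f l)" by (simp add: n_def)
  also have "\<dots> = f 0 + (\<Sum>l<Suc n. f (Suc l))" by (rule sum.lessThan_Suc_shift)
  also have "(\<Sum>l<Suc n. f (Suc l)) = (\<Sum>l<n. f (Suc l)) + f (Suc n)" by (rule sum.lessThan_Suc)
  also have "(\<Sum>l<n. f (Suc l)) = real h * (real h + 1)"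
    using Suc.IH by (simp add: f_def n_def)
  also have "f 0 = real h + 1" by (simp add: f_def)
  also have "f (Suc n) = real h + 1" by (simp add: f_def n_def)
  finally show ?case unfolding f_def by (simp add: algebra_simps)
qed simp

lemma sum_mod_div_split:
  fixes g :: "nat \<Rightarrow> nat \<Rightarrow> 'a::comm_monoid_add"
  assumes "K > 0"
  shows "(\<Sum>i<K * L. g (i mod K) (i div K)) = (\<Sum>l<L. \<Sum>k<K. g k l)"
proof -
  have "(\<Sum>k<K. g k l) = (\<Sum>i\<in>{l * K..<l * K + K}. g (i mod K) (i div K))" for l
  proof (rule sum.reindex_bij_witness[of _ "\<lambda>i. i - l * K" "\<lambda>k. l * K + k"])
    fix k assume "k \<in> {..<K}"
    then have "(l * K + k) mod K = k" "(l * K + k) div K = l" by simp_all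
    then show "g ((l * K + k) mod K) ((l * K + k) div K) = g k l" by (simp only:)
  qed auto
  then have "(\<Sum>l<L. \<Sum>k<K. g k l) = (\<Sum>l<L. \<Sum>i\<in>{l * K..<l * K + K}. g (i mod K) (i div K))"
    by (simp only:)
  also have "\<dots> = (\<Sum>i<L * K. g (i mod K) (i div K))" by (rule sum.nat_group)
  finally show ?thesis by (simp only: mult.commute)
qed

lemma gbinomial_of_int_Ints: "real_of_int a gchoose k \<in> \<int>"
proof -
  have nonneg: "real_of_int a gchoose k \<in> \<int>" if "a \<ge> 0" for a
  proof -
    have "real_of_int a gchoose k = real (nat a choose k)"
      using that by (simp add: binomial_gbinomial)
    then show ?thesis by simp
  qed
  show ?thesis
  proof (cases "a \<ge> 0")
    case False
    have "real_of_int a gchoose k = (-1) ^ k * (real_of_int (int k - a - 1) gchoose k)"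
      by (subst gbinomial_negated_upper) simp
    also have "\<dots> \<in> \<int>" using False by (intro Ints_mult Ints_power nonneg) auto
    finally show ?thesis .
  qed (rule nonneg)
qed

text \<open>\<open>h\<close> is maximal with \<open>18.6 * L ^ 2 \<le> p\<close>. Then
  \<open>m\<close> is maximal with \<open>7 * m * L * ln 16 \<le> p * u / 2\<close>, which for
  \<open>N = 7 * m * L\<close> means that \<open>16 ^ N\<close> does not exceed
  \<open>y ^ (p/2)\<close>, the reciprocal size of the linear form.\<close>

lemma parameters_exist:
  fixes p :: nat and u :: real
  assumes p: "p \<ge> 912" and u: "u \<ge> 13/7"
  obtains h m :: nat where "h \<ge> 3" "m \<ge> 6" "(93/5) * real (2 * h + 1) ^ 2 \<le> p"
    "p \<le> (93/5) * (real (2 * h + 1) + 2) ^ 2"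
    "14 * real (2 * h + 1) * m * ln 16 \<le> p * u"
    "p * u \<le> 14 * real (2 * h + 1) * (real m + 1) * ln 16"
proof -
  define P where "P h \<longleftrightarrow> 93 * (2 * h + 1) ^ 2 \<le> 5 * p" for h :: nat
  define h where "h = (GREATEST h. P h)"
  \<comment> \<open>The threshold on \<open>p\<close> enters here: 93 * 49 = 4557 lies between 5 *
    911 and 5 * 912.\<close>
  have P3: "P 3" using p by (simp add: P_def)
  have bound: "k \<le> p" if "P k" for k
  proof -
    have "k \<le> (2 * k + 1) ^ 2" by (simp add: power2_eq_square)
    then show ?thesis using that unfolding P_def by linarith
  qed
  have Ph: "P h" unfolding h_def by (rule GreatestI_nat[where P = P and k = 3 and b = p]) (use P3 bound in auto)
  have h3: "3 \<le> h" unfolding h_def by (rule Greatest_le_nat[where P = P and k = 3 and b = p]) (use P3 bound in auto)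
  have "\<not> P (Suc h)"
  proof
    assume "P (Suc h)"
    then have "Suc h \<le> h" unfolding h_def by (rule Greatest_le_nat[where P = P and b = p]) (use P3 bound in auto)
    then show False by simp
  qed
  define L where "L = real (2 * h + 1)"
  have L7: "L \<ge> 7" using h3 by (simp add: L_def)
  have lo: "93 * L ^ 2 \<le> 5 * real p"
  proof -
    have "real (93 * (2 * h + 1) ^ 2) \<le> real (5 * p)" using Ph unfolding P_def by (rule of_nat_mono)
    then show ?thesis by (simp add: L_def)
  qed
  have hi: "5 * real p \<le> 93 * (L + 2) ^ 2"
  proof -
    have "5 * p \<le> 93 * (2 * Suc h + 1) ^ 2" using \<open>\<not> P (Suc h)\<close> unfolding P_def by simp
    then have "real (5 * p) \<le> real (93 * (2 * Suc h + 1) ^ 2)" by (rule of_nat_mono)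
    also have "\<dots> = 93 * (L + 2) ^ 2" by (simp add: L_def algebra_simps)
    finally show ?thesis by simp
  qed
  define q where "q = p * u / (14 * L * ln 16)"
  define m where "m = nat \<lfloor>q\<rfloor>"
  have lam: "8/3 \<le> ln (16::real)" "ln (16::real) \<le> 25/9" by (rule ln_16_bounds)+
  have den: "14 * L * ln 16 > 0" using L7 lam by simp
  have "6 \<le> q"
  proof -
    have "6 * (14 * L * ln 16) \<le> 6 * (14 * L * (25/9))" using L7 lam by (intro mult_left_mono) auto
    also have "\<dots> \<le> (93/5) * (7 * L) * (13/7)" using L7 by simp
    also have "\<dots> \<le> (93/5) * (L * L) * (13/7)" using L7 by (intro mult_right_mono mult_left_mono) auto
    also have "\<dots> \<le> p * (13/7)" using lo by (simp add: power2_eq_square)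
    also have "\<dots> \<le> p * u" using u by (intro mult_left_mono) auto
    finally show ?thesis unfolding q_def using den by (simp add: pos_le_divide_eq)
  qed
  then have m6: "m \<ge> 6" unfolding m_def by linarith
  have "real m \<le> q" "q \<le> real m + 1" using \<open>6 \<le> q\<close> unfolding m_def by linarith+
  then have "real m * (14 * L * ln 16) \<le> p * u" "p * u \<le> (real m + 1) * (14 * L * ln 16)"
    unfolding q_def using den by (simp_all add: pos_le_divide_eq pos_divide_le_eq)
  then have mu: "14 * L * m * ln 16 \<le> p * u" "p * u \<le> 14 * L * (real m + 1) * ln 16"
    by (simp_all only: mult_ac)
  show ?thesis
  proof (rule that[of h m])
    show "(93/5) * real (2 * h + 1) ^ 2 \<le> p" "p \<le> (93/5) * (real (2 * h + 1) + 2) ^ 2"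
      using lo hi unfolding L_def[symmetric] by linarith+
  qed (use h3 m6 mu in \<open>simp_all only: L_def\<close>)
qed

section \<open>Nodes with a nonvanishing interpolation determinant\<close>

definition node_pos :: "int \<Rightarrow> int \<Rightarrow> int \<times> int \<Rightarrow> int" where
  "node_pos p r0 t = fst t * p - snd t * r0"

definition node_log :: "real \<Rightarrow> real \<Rightarrow> int \<times> int \<Rightarrow> real" where
  "node_log \<omega> \<gamma> t = of_int (fst t) * \<omega> + of_int (snd t) * \<gamma>"

text \<open>The logarithm of \<open>v\<close> is proportional to the position up to a multiple of
  the tiny \<open>\<Lambda>\<close>, so \<open>v\<close> is almost a function of the position
  alone.\<close>

lemma node_log_eq:
  assumes "p \<noteq> 0" "\<Lambda> = of_int r0 * \<omega> + of_int p * \<gamma>"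
  shows "node_log \<omega> \<gamma> t = \<omega> / of_int p * of_int (node_pos p r0 t) + of_int (snd t) * \<Lambda> / of_int p"
  using assms(1) unfolding node_log_def node_pos_def assms(2) by (simp add: field_simps)

text \<open>The nodes contain all sums of a small set \<open>E1\<close> and a large set
  \<open>E2\<close>, as the zero estimate requires. Positions are injective on \<open>E2\<close>
  because \<open>p\<close> is prime. On \<open>E1\<close> equal values of \<open>v\<close> force
  \<open>\<omega> * |z - z'| \<le> 2 * h * |\<Lambda>| < \<omega>\<close>, hence equal integer
  positions.\<close>

lemma interpolation_nodes_exist:
  fixes p r0 :: int and h m :: nat and \<omega> \<gamma> \<Lambda> :: real
  assumes p: "prime p" and r0: "r0 \<noteq> 0" "\<bar>r0\<bar> < p" and \<Lambda>: "\<Lambda> = of_int r0 * \<omega> + of_int p * \<gamma>"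
    and small: "2 * real h * \<bar>\<Lambda>\<bar> < \<omega>" and hp: "2 * (7 * int h + 3) < p" and m: "m > 0"
    and K: "K = 7 * m" and L: "L = 2 * h + 1"
  shows "\<exists>t. (\<forall>j<K * L. \<bar>snd (t j)\<bar> \<le> 8 * int h + 3 \<and> 2 * \<bar>node_pos p r0 (t j)\<bar> \<le> (int m + 1) * p) \<and>
     det (mat (K * L) (K * L) (\<lambda>(j,i). (of_int (node_pos p r0 (t j)) gchoose (i mod K)) *
        exp (node_log \<omega> \<gamma> (t j)) ^ (i div K))) \<noteq> 0"
proof -
  have p0: "p > 0" using p by (simp add: prime_gt_0_int)
  have \<omega>: "\<omega> > 0"
  proof -
    have "0 \<le> 2 * real h * \<bar>\<Lambda>\<bar>" by simp
    then show ?thesis using small by linarith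
  qed
  define z where "z t = real_of_int (node_pos p r0 t)" for t
  define v where "v t = exp (node_log \<omega> \<gamma> t)" for t
  define E where "E = {t. \<bar>snd t\<bar> \<le> 8 * int h + 3 \<and> 2 * \<bar>node_pos p r0 t\<bar> \<le> (int m + 1) * p}"
  obtain E1 where E1: "finite E1" "card E1 = (2 * h + 1) * 1"
     "\<forall>(r, s)\<in>E1. \<bar>s\<bar> \<le> int h \<and> 2 * \<bar>r * p - s * r0\<bar> \<le> int 1 * p"
    using node_set_exists[OF p0, of h 1 r0] by blast
  obtain E2 where E2: "finite E2" "card E2 = (2 * (7 * h + 3) + 1) * m"
     "\<forall>(r, s)\<in>E2. \<bar>s\<bar> \<le> int (7 * h + 3) \<and> 2 * \<bar>r * p - s * r0\<bar> \<le> int m * p"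
    using node_set_exists[OF p0, of "7 * h + 3" m r0] by blast
  have E1': "\<bar>snd t\<bar> \<le> int h" "2 * \<bar>node_pos p r0 t\<bar> \<le> p" if "t \<in> E1" for t
    using E1(3) that by (auto simp: node_pos_def case_prod_beta)
  have E2': "\<bar>snd t\<bar> \<le> 7 * int h + 3" "2 * \<bar>node_pos p r0 t\<bar> \<le> int m * p" if "t \<in> E2" for t
    using E2(3) that by (auto simp: node_pos_def case_prod_beta)
  have pos_inj: "s = t" if "node_pos p r0 s = node_pos p r0 t" "\<bar>snd s\<bar> \<le> 7 * int h + 3" "\<bar>snd t\<bar> \<le> 7 * int h + 3" for s t
  proof -
    have "\<bar>snd s - snd t\<bar> \<le> \<bar>snd s\<bar> + \<bar>snd t\<bar>" by (rule abs_triangle_ineq4)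
    also have "\<dots> \<le> 2 * (7 * int h + 3)" using add_mono[OF that(2,3)] by simp
    also have "\<dots> < p" by (rule hp)
    finally have "\<bar>snd s - snd t\<bar> < p" .
    then have "fst s = fst t \<and> snd s = snd t"
      using node_position_inj[OF p r0] that(1) unfolding node_pos_def by blast
    then show ?thesis by (simp add: prod_eq_iff)
  qed
  have "inj_on z E2"
    unfolding z_def using E2' pos_inj by (intro inj_onI) auto
  then have "card (z ` E2) = card E2" by (rule card_image)
  \<comment> \<open>\<open>2 * (7 * h + 3) + 1 = 7 * L\<close>: the factor 7 in \<open>K\<close> and
    the bound \<open>7 * h + 3\<close> are tuned to each other.\<close>
  also have "\<dots> = K * L" by (simp add: E2(2) K L algebra_simps)
  finally have "card (z ` E2) = K * L" .
  moreover have "(K - 1) * L < K * L" using m by (intro mult_less_mono1) (auto simp: K L)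
  ultimately have cardz: "(K - 1) * L < card (z ` E2)" by simp
  have "inj_on v E1"
  proof (rule inj_onI)
    fix s t assume st: "s \<in> E1" "t \<in> E1" "v s = v t"
    have "node_log \<omega> \<gamma> s = node_log \<omega> \<gamma> t" using st(3) by (simp add: v_def)
    then have "\<omega> * (of_int (node_pos p r0 s) - of_int (node_pos p r0 t)) = (of_int (snd t) - of_int (snd s)) * \<Lambda>"
      using p0 unfolding node_log_eq[OF less_imp_neq[OF p0, symmetric] \<Lambda>] by (simp add: field_simps)
    then have "\<omega> * \<bar>of_int (node_pos p r0 s) - of_int (node_pos p r0 t)\<bar> = \<bar>of_int (snd t) - of_int (snd s)\<bar> * \<bar>\<Lambda>\<bar>"
      using \<omega> by (metis abs_mult abs_of_pos)
    also have "\<dots> \<le> (2 * real h) * \<bar>\<Lambda>\<bar>"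
    proof (rule mult_right_mono)
      have "\<bar>snd t - snd s\<bar> \<le> 2 * int h" using E1'(1)[OF st(1)] E1'(1)[OF st(2)] by linarith
      then show "\<bar>of_int (snd t) - real_of_int (snd s)\<bar> \<le> 2 * real h" by linarith
    qed simp
    also have "\<dots> < \<omega> * 1" using small by simp
    finally have "\<bar>real_of_int (node_pos p r0 s) - of_int (node_pos p r0 t)\<bar> < 1"
      using \<omega> by (simp only: mult_less_cancel_left_pos)
    then have "node_pos p r0 s = node_pos p r0 t" by linarith
    then show "s = t" by (rule pos_inj) (use E1'(1)[OF st(1)] E1'(1)[OF st(2)] in linarith)+
  qed
  then have cardv: "L \<le> card (v ` E1)" using E1(2) by (simp add: card_image L)
  have "\<exists>t. (\<forall>j<K * L. t j \<in> E) \<and> det (mat (K * L) (K * L) (\<lambda>(j,i). (z (t j) gchoose (i mod K)) * v (t j) ^ (i div K))) \<noteq> 0"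
  proof (rule nonzero_minor_exists)
    fix c :: "nat \<Rightarrow> real"
    assume c: "\<And>t. t \<in> E \<Longrightarrow> (\<Sum>i<K * L. c i * ((z t gchoose (i mod K)) * v t ^ (i div K))) = 0"
    have vanish: "(\<Sum>i<K * L. c i * (((z s + z t) gchoose (i mod K)) * (v s * v t) ^ (i div K))) = 0"
      if st: "s \<in> E1" "t \<in> E2" for s t
    proof -
      \<comment> \<open>Nodes are added coordinatewise; positions then add and the values of
        \<open>v\<close> multiply.\<close>
      define w where "w = (fst s + fst t, snd s + snd t)"
      have np: "node_pos p r0 w = node_pos p r0 s + node_pos p r0 t"
        by (simp add: w_def node_pos_def algebra_simps)
      have "\<bar>node_pos p r0 w\<bar> \<le> \<bar>node_pos p r0 s\<bar> + \<bar>node_pos p r0 t\<bar>" unfolding np by (rule abs_triangle_ineq)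
      then have "2 * \<bar>node_pos p r0 w\<bar> \<le> (int m + 1) * p"
        using E1'(2)[OF st(1)] E2'(2)[OF st(2)] by (simp add: distrib_right)
      moreover have "\<bar>snd w\<bar> \<le> 8 * int h + 3"
        using E1'(1)[OF st(1)] E2'(1)[OF st(2)] by (simp add: w_def)
      ultimately have "w \<in> E" by (simp add: E_def)
      then have "(\<Sum>i<K * L. c i * ((z w gchoose (i mod K)) * v w ^ (i div K))) = 0" by (rule c)
      moreover have "z w = z s + z t" by (simp add: z_def np)
      moreover have "v w = v s * v t" by (simp add: v_def w_def node_log_def exp_add[symmetric] algebra_simps)
      ultimately show ?thesis by (simp only:)
    qed
    have v0: "v t \<noteq> 0" for t by (simp add: v_def)
    show "\<forall>i<K * L. c i = 0"
      by (rule gbinomial_exponential_independent[where z = z and v = v and c = c, OF _ _ E1(1) cardv E2(1) cardz])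
         (erule (1) vanish, rule v0)
  qed
  then show ?thesis unfolding z_def v_def E_def by auto
qed

lemma cosh_ln_16: "cosh (ln 16) = (257/32 :: real)"
  by (simp add: cosh_def exp_minus)

text \<open>The factor 2 in the bound is 1 + 1/10 + 9/10: the exponential of the part proportional
  to \<open>z\<close>, the slack of \<open>cheb_norm_le_exp\<close>, and the perturbation by
  \<open>\<Lambda>\<close>.\<close>

lemma cheb_norm_le_interpolation_entry:
  fixes A \<omega> p \<Lambda> :: real and z s :: "nat \<Rightarrow> real"
  assumes N: "N > 0" and A: "A > 0" and z: "\<And>j. j < N \<Longrightarrow> \<bar>z j\<bar> \<le> A" and p: "p > 0"
    and s: "\<And>j. j < N \<Longrightarrow> \<bar>l * s j\<bar> \<le> M"
    and small: "2 * (M * \<bar>\<Lambda>\<bar> / p) * exp (real N * ln 16) \<le> 9/10"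
    and X: "\<omega> / p * A * (257/32) = X" and \<omega>: "\<omega> \<ge> 0" and k: "k \<le> K"
  shows "cheb_norm_le {..<N} (\<lambda>j. arccos (z j / A)) N (ln 16)
     (\<lambda>j. (z j gchoose k) * exp (l * (\<omega> / p * z j + s j * \<Lambda> / p)))
     ((A * (257/32) + real K) ^ k / fact k * (2 * exp (\<bar>l\<bar> * X)))"
proof -
  let ?c = "cheb_norm_le {..<N} (\<lambda>j. arccos (z j / A)) N (ln 16)"
  have ne: "{..<N} \<noteq> {}" using N by auto
  have eta: "0 \<le> ln (16::real)" by simp
  \<comment> \<open>With these angles \<open>z\<close> is \<open>A\<close> times the first Chebyshev
    polynomial, of norm \<open>A * cosh (ln 16)\<close>.\<close>
  have "?c (\<lambda>j. A * cos (real 1 * arccos (z j / A))) (\<bar>A\<bar> * cosh (real 1 * ln 16))"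
    by (intro cheb_norm_le_scale cheb_norm_le_cos eta)
  moreover have "A * cos (real 1 * arccos (z j / A)) = z j" if "j < N" for j
  proof -
    have "\<bar>z j / A\<bar> \<le> 1" using z[OF that] A by simp
    then show ?thesis using A by (simp add: cos_arccos_abs)
  qed
  ultimately have zc: "?c z (A * (257/32))"
    using A by (auto simp: cosh_ln_16 intro: cheb_norm_le_cong[where f = "\<lambda>j. A * cos (real 1 * arccos (z j / A))"])
  have gb: "?c (\<lambda>j. z j gchoose k) ((A * (257/32) + real K) ^ k / fact k)"
    by (rule cheb_norm_le_gbinomial[OF zc eta ne]) (use k in simp)
  have "?c (\<lambda>j. (l * \<omega> / p) * z j) (\<bar>l * \<omega> / p\<bar> * (A * (257/32)))"
    by (rule cheb_norm_le_scale[OF zc])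
  moreover have "\<bar>l * \<omega> / p\<bar> * (A * (257/32)) = \<bar>l\<bar> * X"
    using \<omega> p unfolding X[symmetric] by (simp add: abs_mult)
  ultimately have lz: "?c (\<lambda>j. (l * \<omega> / p) * z j) (\<bar>l\<bar> * X)" by simp
  have e1: "?c (\<lambda>j. exp ((l * \<omega> / p) * z j)) (exp (\<bar>l\<bar> * X) + exp (\<bar>l\<bar> * X) / 10)"
    by (rule cheb_norm_le_exp[OF lz eta ne]) simp
  define \<tau> where "\<tau> = 2 * (M * \<bar>\<Lambda>\<bar> / p)"
  have M0: "0 \<le> M" using s[OF N] abs_ge_zero[of "l * s 0"] by linarith
  have \<tau>0: "0 \<le> \<tau>" unfolding \<tau>_def using M0 p by simp
  have "\<tau> * 1 \<le> \<tau> * exp (real N * ln 16)" using \<tau>0 by (intro mult_left_mono) auto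
  then have \<tau>1: "\<tau> \<le> 9/10" using small unfolding \<tau>_def[symmetric] by linarith
  \<comment> \<open>The perturbation involves \<open>s j\<close>, so it is not expanded but put into
    the remainder. That costs at most \<open>16 ^ N\<close>, which the hypothesis
    \<open>small\<close> outweighs.\<close>
  have e2: "?c (\<lambda>j. exp ((l * \<omega> / p) * z j) * (exp (l * s j * \<Lambda> / p) - 1)) (exp (\<bar>l\<bar> * X) * \<tau> * cosh (real N * ln 16))"
  proof (rule cheb_norm_le_bounded)
    fix j assume "j \<in> {..<N}"
    then have j: "j < N" by simp
    have "\<bar>(l * \<omega> / p) * z j\<bar> \<le> \<bar>l\<bar> * X" by (rule cheb_norm_le_abs[OF lz]) (use j in simp)
    then have 1: "exp ((l * \<omega> / p) * z j) \<le> exp (\<bar>l\<bar> * X)"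
      by (simp only: exp_le_cancel_iff abs_le_iff)
    have "\<bar>l * s j * \<Lambda> / p\<bar> = \<bar>l * s j\<bar> * \<bar>\<Lambda>\<bar> / p" using p by (simp add: abs_mult)
    also have "\<dots> \<le> M * \<bar>\<Lambda>\<bar> / p" using s[OF j] p by (intro divide_right_mono mult_right_mono) auto
    finally have 2: "2 * \<bar>l * s j * \<Lambda> / p\<bar> \<le> \<tau>" by (simp add: \<tau>_def)
    then have "\<bar>exp (l * s j * \<Lambda> / p) - 1\<bar> \<le> \<tau>"
      using abs_exp_minus_1_le[of "l * s j * \<Lambda> / p"] \<tau>1 by linarith
    then show "\<bar>exp ((l * \<omega> / p) * z j) * (exp (l * s j * \<Lambda> / p) - 1)\<bar> \<le> exp (\<bar>l\<bar> * X) * \<tau>"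
      unfolding abs_mult using 1 by (intro mult_mono) auto
  qed (use \<tau>0 in simp)
  have "cosh (real N * ln 16) \<le> exp (real N * ln 16)"
    unfolding cosh_def using eta by simp
  then have "\<tau> * cosh (real N * ln 16) \<le> \<tau> * exp (real N * ln 16)" using \<tau>0 by (rule mult_left_mono)
  then have "\<tau> * cosh (real N * ln 16) \<le> 9/10" using small unfolding \<tau>_def[symmetric] by linarith
  then have "exp (\<bar>l\<bar> * X) * (\<tau> * cosh (real N * ln 16)) \<le> exp (\<bar>l\<bar> * X) * (9/10)" by (intro mult_left_mono) auto
  then have le: "exp (\<bar>l\<bar> * X) + exp (\<bar>l\<bar> * X) / 10 + exp (\<bar>l\<bar> * X) * \<tau> * cosh (real N * ln 16) \<le> 2 * exp (\<bar>l\<bar> * X)"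
    unfolding mult.assoc by linarith
  have e3: "?c (\<lambda>j. exp (l * (\<omega> / p * z j + s j * \<Lambda> / p))) (2 * exp (\<bar>l\<bar> * X))"
  proof (rule cheb_norm_le_cong[OF cheb_norm_le_mono[OF cheb_norm_le_add[OF e1 e2] le]])
    fix j
    have "exp (l * (\<omega> / p * z j + s j * \<Lambda> / p)) = exp ((l * \<omega> / p) * z j) * exp (l * s j * \<Lambda> / p)"
      by (simp add: exp_add[symmetric] distrib_left mult.assoc)
    then show "exp ((l * \<omega> / p) * z j) + exp ((l * \<omega> / p) * z j) * (exp (l * s j * \<Lambda> / p) - 1) =
        exp (l * (\<omega> / p * z j + s j * \<Lambda> / p))" by (simp add: algebra_simps)
  qed
  show ?thesis by (rule cheb_norm_le_mult[OF gb e3 eta ne])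
qed

lemma det_mat_row_col_scale:
  "det (mat N N (\<lambda>(j,i). a j * b i * f j i)) = (\<Prod>j<N. a j) * (\<Prod>i<N. b i) * det (mat N N (\<lambda>(j,i). f j i))"
proof -
  have "(\<Prod>j<N. a j * b (p j) * f j (p j)) = (\<Prod>j<N. a j) * (\<Prod>i<N. b i) * (\<Prod>j<N. f j (p j))"
    if "p permutes {..<N}" for p
    using prod.permute[OF that, of b] by (simp add: prod.distrib o_def)
  then show ?thesis
    unfolding det_mat_Leibniz sum_distrib_left by (intro sum.cong refl) (simp add: mult_ac)
qed

text \<open>With columns indexed by \<open>i = l * K + k\<close>, this sends \<open>l\<close> to
  \<open>L - 1 - l\<close> and keeps \<open>k\<close>; on exponents centred at \<open>h\<close> it
  is negation, the effect of conjugation.\<close>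

definition block_rev :: "nat \<Rightarrow> nat \<Rightarrow> nat \<Rightarrow> nat" where
  "block_rev K L i = (if i < K * L then K * (L - 1 - i div K) + i mod K else i)"

lemma block_rev:
  assumes "K > 0"
  shows "block_rev K L permutes {..<K * L}"
    and "\<And>i. i < K * L \<Longrightarrow> block_rev K L i div K = L - 1 - i div K"
    and "\<And>i. i < K * L \<Longrightarrow> block_rev K L i mod K = i mod K"
proof -
  let ?\<pi> = "block_rev K L"
  have dm: "i mod K < K" for i using assms by simp
  have dv: "i div K < L" if "i < K * L" for i
    using that assms by (simp add: div_less_iff_less_mult mult.commute)
  show div: "?\<pi> i div K = L - 1 - i div K" if "i < K * L" for i
    using that assms dm by (simp add: block_rev_def)
  show mod: "?\<pi> i mod K = i mod K" if "i < K * L" for i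
    using that by (simp add: block_rev_def)
  have lt: "?\<pi> i < K * L" if "i < K * L" for i
  proof -
    have "?\<pi> i < K * (L - 1 - i div K) + K" using that dm by (simp add: block_rev_def)
    also have "\<dots> = K * (L - 1 - i div K + 1)" by simp
    also have "\<dots> \<le> K * L" using dv[OF that] by (intro mult_le_mono2) linarith
    finally show ?thesis .
  qed
  have inv: "?\<pi> (?\<pi> i) = i" for i
  proof (cases "i < K * L")
    case True
    have "?\<pi> (?\<pi> i) = K * (L - 1 - ?\<pi> i div K) + ?\<pi> i mod K" using lt[OF True] by (subst block_rev_def) (simp only: if_True)
    also have "\<dots> = K * (i div K) + i mod K"
      using dv[OF True] unfolding div[OF True] mod[OF True] by simp
    finally show ?thesis by simp
  qed (simp add: block_rev_def)
  show "?\<pi> permutes {..<K * L}"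
    unfolding permutes_def
  proof (intro conjI allI impI)
    fix y show "\<exists>!x. ?\<pi> x = y" by (rule ex1I[of _ "?\<pi> y"]) (use inv in auto)
  qed (simp add: block_rev_def)
qed

text \<open>Clearing denominators column by column gives a matrix over Z[sqrt 2] whose determinant
  is at least 1 in absolute value. The Chebyshev bound limits the same determinant from above;
  taking logarithms contradicts \<open>parameter_inequality\<close>.\<close>

lemma no_small_linear_form:
  fixes p :: nat and y r0 :: int and \<alpha> :: zsqrt2 and \<Lambda> :: real
  assumes p: "prime p" "p \<ge> 912" and y: "y \<ge> 7" and \<alpha>: "\<bar>nrm \<alpha>\<bar> = y"
    and r0: "r0 \<noteq> 0" "2 * \<bar>r0\<bar> < int p"
    and \<Lambda>: "\<Lambda> = of_int r0 * (2 * ln eps) + of_int (int p) * ln (emb \<alpha> ^ 2 / y)"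
    and small: "\<bar>\<Lambda>\<bar> * exp (p * ln y / 2) \<le> 4"
  shows False
proof -
  define u where "u = ln (real_of_int y)"
  define \<omega> where "\<omega> = 2 * ln eps"
  define \<gamma> where "\<gamma> = ln (emb \<alpha> ^ 2 / y)"
  have u: "u \<ge> 13/7"
  proof -
    have "ln 7 \<le> u" unfolding u_def using y by simp
    then show ?thesis using ln_7_ge by linarith
  qed
  have \<omega>: "\<omega> \<ge> 1" unfolding \<omega>_def by (rule ln_eps_bounds)
  obtain h m :: nat where h: "h \<ge> 3" and m: "m \<ge> 6" and lo: "(93/5) * real (2 * h + 1) ^ 2 \<le> p"
    and hi: "p \<le> (93/5) * (real (2 * h + 1) + 2) ^ 2"
    and mu: "14 * real (2 * h + 1) * m * ln 16 \<le> p * u" "p * u \<le> 14 * real (2 * h + 1) * (real m + 1) * ln 16"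
    by (rule parameters_exist[OF p(2) u])
  define L where "L = 2 * h + 1"
  define K where "K = 7 * m"
  define N where "N = K * L"
  define \<sigma> where "\<sigma> = 8 * h + 3"
  define A where "A = (real m + 1) * p / 2"
  define B where "B = (real m + 1) * p / 2 * (257/32) + K"
  define X where "X = 2 * ln eps * (real m + 1) / 2 * (257/32)"
  define M where "M = real h * (8 * real h + 3)"
  have K0: "K > 0" using m by (simp add: K_def)
  have N0: "N > 0" using K0 by (simp add: N_def L_def)
  have p0: "real p > 0" using p by simp
  \<comment> \<open>\<open>M \<le> 2 * L ^ 2 \<le> 10 * p / 93\<close>. The constants are chosen so
    that \<open>8 * M / p \<le> 9/10\<close>, as \<open>small2\<close> needs.\<close>
  have Mp: "160 * M \<le> 18 * real p"
  proof -
    have "M \<le> 2 * real (2 * h + 1) ^ 2" by (simp add: M_def power2_eq_square algebra_simps)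
    then show ?thesis using lo p0 by linarith
  qed
  have hpr: "14 * real h + 6 < p"
  proof -
    define d where "d = real h * real h"
    have "3 * real h \<le> d" unfolding d_def using h by (intro mult_right_mono) auto
    moreover have "3 \<le> real h" using h by simp
    moreover have "8 * d \<le> M" by (simp add: M_def d_def algebra_simps)
    ultimately show ?thesis using Mp p0 by linarith
  qed
  have hp: "2 * (7 * int h + 3) < int p"
  proof -
    have "real_of_int (2 * (7 * int h + 3)) < real_of_int (int p)" using hpr by simp
    then show ?thesis by (simp only: of_int_less_iff)
  qed
  have expN: "exp (real N * ln 16) \<le> exp (p * u / 2)"
    using mu(1) by (simp add: N_def K_def L_def algebra_simps)
  have small2: "2 * (M * \<bar>\<Lambda>\<bar> / p) * exp (real N * ln 16) \<le> 9/10"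
  proof -
    have M0: "0 \<le> M" by (simp add: M_def)
    have "\<bar>\<Lambda>\<bar> * exp (real N * ln 16) \<le> \<bar>\<Lambda>\<bar> * exp (p * u / 2)" using expN by (intro mult_left_mono) auto
    also have "\<dots> \<le> 4" using small by (simp add: u_def)
    finally have "2 * (M / p) * (\<bar>\<Lambda>\<bar> * exp (real N * ln 16)) \<le> 2 * (M / p) * 4"
      using M0 by (intro mult_left_mono) auto
    also have "\<dots> \<le> 9/10" using Mp p0 by (simp add: field_simps)
    finally show ?thesis by (simp add: mult_ac)
  qed
  have small1: "2 * real h * \<bar>\<Lambda>\<bar> < \<omega>"
  proof -
    have "8 * real h < p * u / 2 + 1"
    proof -
      have "real p * (13/7) \<le> p * u" using u by (intro mult_left_mono) auto
      then show ?thesis using hpr by linarith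
    qed
    also have "\<dots> \<le> exp (p * u / 2)" using exp_ge_add_one_self[of "p * u / 2"] by linarith
    finally have "8 * real h < exp (p * u / 2)" .
    show ?thesis
    proof (cases "\<Lambda> = 0")
      case False
      then have "\<bar>\<Lambda>\<bar> * (8 * real h) < \<bar>\<Lambda>\<bar> * exp (p * u / 2)"
        using \<open>8 * real h < exp (p * u / 2)\<close> by (intro mult_strict_left_mono) auto
      then have "\<bar>\<Lambda>\<bar> * (8 * real h) < 4" using small by (simp add: u_def)
      then show ?thesis using \<omega> by (simp add: mult_ac)
    qed (use \<omega> in simp)
  qed
  have pr: "prime (int p)" using p(1) by simp
  have r0': "\<bar>r0\<bar> < int p" using r0(2) by linarith
  obtain t where t: "\<And>j. j < N \<Longrightarrow> \<bar>snd (t j)\<bar> \<le> 8 * int h + 3"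
      "\<And>j. j < N \<Longrightarrow> 2 * \<bar>node_pos (int p) r0 (t j)\<bar> \<le> (int m + 1) * int p"
    and det_ne: "det (mat N N (\<lambda>(j,i). (of_int (node_pos (int p) r0 (t j)) gchoose (i mod K)) *
        exp (node_log \<omega> \<gamma> (t j)) ^ (i div K))) \<noteq> 0"
    using interpolation_nodes_exist[OF pr r0(1) r0' \<Lambda>[folded \<omega>_def \<gamma>_def] small1 hp _ K_def L_def] m
    unfolding N_def by auto
  define z where "z j = real_of_int (node_pos (int p) r0 (t j))" for j
  define li where "li i = int (i div K) - int h" for i
  define l where "l i = real_of_int (li i)" for i
  define G where "G j i = (z j gchoose (i mod K)) * exp (l i * node_log \<omega> \<gamma> (t j))" for j i
  \<comment> \<open>Enough powers of \<open>y\<close> to clear \<open>g\<close> raised to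
    \<open>li i * s\<close> for all \<open>|s| \<le> \<sigma>\<close>; the bound is proportional to
    the centred exponent, so middle columns are cheap.\<close>
  define b where "b i = real_of_int y ^ (\<sigma> * nat \<bar>li i\<bar>)" for i
  define q where "q j i = of_int \<lfloor>z j gchoose (i mod K)\<rfloor> * eps2_pow (li i * fst (t j)) *
      scaled_pow \<alpha> y (\<sigma> * nat \<bar>li i\<bar>) (li i * snd (t j))" for j i
  have li_le: "\<bar>li i\<bar> \<le> int h" if "i < N" for i
  proof -
    have "i div K < L" using that K0 unfolding N_def by (simp add: div_less_iff_less_mult mult.commute)
    then show ?thesis by (simp add: li_def L_def)
  qed
  have emb_q: "emb (q j i) = b i * G j i" if "i < N" "j < N" for i j
  proof -
    have "z j gchoose (i mod K) \<in> \<int>" unfolding z_def by (rule gbinomial_of_int_Ints)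
    then have 1: "real_of_int \<lfloor>z j gchoose (i mod K)\<rfloor> = z j gchoose (i mod K)" by (auto elim: Ints_cases)
    have "\<bar>li i\<bar> * \<bar>snd (t j)\<bar> \<le> \<bar>li i\<bar> * int \<sigma>"
      using t(1)[OF that(2)] by (intro mult_left_mono) (auto simp: \<sigma>_def)
    then have 2: "\<bar>li i * snd (t j)\<bar> \<le> int (\<sigma> * nat \<bar>li i\<bar>)" by (simp add: abs_mult mult.commute)
    have "emb (q j i) = (z j gchoose (i mod K)) * exp (\<omega> * (li i * fst (t j))) * (b i * exp (of_int (li i * snd (t j)) * \<gamma>))"
      unfolding q_def emb_simps emb_eps2_pow 1 b_def \<omega>_def \<gamma>_def
      using emb_scaled_pow[OF \<alpha> _ 2] y by simp
    also have "\<dots> = b i * ((z j gchoose (i mod K)) * (exp (\<omega> * (li i * fst (t j))) * exp (of_int (li i * snd (t j)) * \<gamma>)))"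
      by (simp only: mult_ac)
    also have "exp (\<omega> * (li i * fst (t j))) * exp (of_int (li i * snd (t j)) * \<gamma>) = exp (l i * node_log \<omega> \<gamma> (t j))"
      unfolding exp_add[symmetric] by (simp add: l_def node_log_def algebra_simps)
    finally show ?thesis by (simp only: G_def)
  qed
  have emb_det: "emb (det (mat N N (\<lambda>(j,i). q j i))) = det (mat N N (\<lambda>(j,i). b i * G j i))"
  proof -
    have "emb (det (mat N N (\<lambda>(j,i). q j i))) = det (map_mat emb (mat N N (\<lambda>(j,i). q j i)))"
      by (rule emb.hom_det[symmetric])
    also have "map_mat emb (mat N N (\<lambda>(j,i). q j i)) = mat N N (\<lambda>(j,i). b i * G j i)"
      by (rule eq_matI) (auto simp: emb_q)
    finally show ?thesis .
  qed
  have nz: "det (mat N N (\<lambda>(j,i). q j i)) \<noteq> 0"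
  proof
    assume "det (mat N N (\<lambda>(j,i). q j i)) = 0"
    then have "det (mat N N (\<lambda>(j,i). b i * G j i)) = 0" using emb_det by (simp add: emb_simps)
    \<comment> \<open>Centring the exponents multiplies each row by a nonzero factor, so the
      determinant from the zero estimate, with exponents \<open>0, ..., L - 1\<close>, is still the
      relevant one.\<close>
    moreover have "mat N N (\<lambda>(j,i). b i * G j i) = mat N N (\<lambda>(j,i). exp (- real h * node_log \<omega> \<gamma> (t j)) * b i *
        ((z j gchoose (i mod K)) * exp (node_log \<omega> \<gamma> (t j)) ^ (i div K)))"
    proof (rule eq_matI, goal_cases)
      case (1 j i)
      have "exp (l i * node_log \<omega> \<gamma> (t j)) = exp (- real h * node_log \<omega> \<gamma> (t j)) * exp (node_log \<omega> \<gamma> (t j)) ^ (i div K)"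
        unfolding exp_of_nat_mult[symmetric] exp_add[symmetric] by (simp add: l_def li_def algebra_simps)
      then show ?case using 1 by (simp add: G_def)
    qed auto
    ultimately have "(\<Prod>j<N. exp (- real h * node_log \<omega> \<gamma> (t j))) * (\<Prod>i<N. b i) *
        det (mat N N (\<lambda>(j,i). (z j gchoose (i mod K)) * exp (node_log \<omega> \<gamma> (t j)) ^ (i div K))) = 0"
      by (simp only: det_mat_row_col_scale)
    moreover have "(\<Prod>j<N. exp (- real h * node_log \<omega> \<gamma> (t j))) \<noteq> 0" by simp
    moreover have "(\<Prod>i<N. b i) \<noteq> 0" using y by (simp add: b_def)
    ultimately show False using det_ne unfolding z_def by simp
  qed
  have "1 \<le> \<bar>emb (det (mat N N (\<lambda>(j,i). q j i)))\<bar>"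
  proof (rule abs_emb_det_ge_1[OF block_rev(1)[OF K0, of L, folded N_def] _ nz])
    fix i j assume ij: "i < N" "j < N"
    have m': "block_rev K L i mod K = i mod K" and d': "block_rev K L i div K = L - 1 - i div K"
      using block_rev(2,3)[OF K0, of i L] ij unfolding N_def by auto
    have "i div K < L" using ij(1) K0 unfolding N_def by (simp add: div_less_iff_less_mult mult.commute)
    then have "int (L - 1 - i div K) = 2 * int h - int (i div K)" unfolding L_def by linarith
    then have "li (block_rev K L i) = - li i" by (simp add: li_def d')
    then show "conj2 (q j i) = q j (block_rev K L i)"
      by (simp add: q_def m' conj2.hom_mult conj2_eps2_pow conj2_scaled_pow)
  qed
  also have "\<dots> \<le> fact N * 2 ^ N * exp (- ln 16 * real (N * (N - 1) div 2)) *
     (\<Prod>i<N. b i * (B ^ (i mod K) / fact (i mod K) * (2 * exp (\<bar>l i\<bar> * X))))"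
    unfolding emb_det
  proof (rule abs_det_le_cheb)
    fix i assume i: "i < N"
    have "cheb_norm_le {..<N} (\<lambda>j. arccos (z j / A)) N (ln 16)
       (\<lambda>j. (z j gchoose (i mod K)) * exp (l i * (\<omega> / p * z j + of_int (snd (t j)) * \<Lambda> / p)))
       ((A * (257/32) + real K) ^ (i mod K) / fact (i mod K) * (2 * exp (\<bar>l i\<bar> * X)))"
    proof (rule cheb_norm_le_interpolation_entry[OF N0 _ _ p0 _ small2])
      show "A > 0" using p0 by (simp add: A_def)
      show "\<bar>z j\<bar> \<le> A" if "j < N" for j
      proof -
        have "real_of_int (2 * \<bar>node_pos (int p) r0 (t j)\<bar>) \<le> real_of_int ((int m + 1) * int p)"
          using t(2)[OF that] by (simp only: of_int_le_iff)
        then show ?thesis by (simp add: z_def A_def)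
      qed
      show "\<bar>l i * of_int (snd (t j))\<bar> \<le> M" if "j < N" for j
      proof -
        have "\<bar>l i\<bar> \<le> real h" using li_le[OF i] by (simp add: l_def)
        moreover have "\<bar>real_of_int (snd (t j))\<bar> \<le> 8 * real h + 3" using t(1)[OF that] by linarith
        ultimately show ?thesis unfolding abs_mult M_def by (intro mult_mono) auto
      qed
      show "\<omega> / p * A * (257/32) = X" using p0 by (simp add: A_def X_def \<omega>_def)
      show "0 \<le> \<omega>" using \<omega> by simp
      show "i mod K \<le> K" using K0 by (simp add: less_imp_le)
    qed
    moreover have "node_log \<omega> \<gamma> (t j) = \<omega> / p * z j + of_int (snd (t j)) * \<Lambda> / p" for j
      using node_log_eq[of "int p" \<Lambda> r0 \<omega> \<gamma> "t j"] p0 \<Lambda>[folded \<omega>_def \<gamma>_def] by (simp add: z_def)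
    moreover have "A * (257/32) + real K = B" by (simp add: A_def B_def)
    ultimately have "cheb_norm_le {..<N} (\<lambda>j. arccos (z j / A)) N (ln 16) (\<lambda>j. G j i)
       (B ^ (i mod K) / fact (i mod K) * (2 * exp (\<bar>l i\<bar> * X)))"
      by (simp only: G_def)
    then have "cheb_norm_le {..<N} (\<lambda>j. arccos (z j / A)) N (ln 16) (\<lambda>j. b i * G j i)
       (\<bar>b i\<bar> * (B ^ (i mod K) / fact (i mod K) * (2 * exp (\<bar>l i\<bar> * X))))"
      by (rule cheb_norm_le_scale)
    moreover have "\<bar>b i\<bar> = b i" using y by (simp add: b_def)
    ultimately show "cheb_norm_le {..<N} (\<lambda>j. arccos (z j / A)) N (ln 16) (\<lambda>j. b i * G j i)
       (b i * (B ^ (i mod K) / fact (i mod K) * (2 * exp (\<bar>l i\<bar> * X))))" by simp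
  qed simp
  finally have ge1: "1 \<le> fact N * 2 ^ N * exp (- ln 16 * real (N * (N - 1) div 2)) *
     (\<Prod>i<N. b i * (B ^ (i mod K) / fact (i mod K) * (2 * exp (\<bar>l i\<bar> * X))))" .
  have B0: "B > 0" unfolding B_def using K0 p0 by (intro add_nonneg_pos) auto
  have b0: "b i > 0" for i using y by (simp add: b_def)
  define F where "F i = b i * (B ^ (i mod K) / fact (i mod K) * (2 * exp (\<bar>l i\<bar> * X)))" for i
  have F0: "F i > 0" for i using B0 b0 by (simp add: F_def)
  \<comment> \<open>Besides \<open>ln 2\<close>, the column bound splits into a part in
    \<open>k\<close> alone and a multiple of the distance of \<open>l\<close> from \<open>h\<close>;
    the sum over all columns then factors.\<close>
  have lnF: "ln (F i) = ln 2 + ((real (i mod K) * ln B - ln (fact (i mod K))) + \<bar>real (i div K) - real h\<bar> * (X + real \<sigma> * u))" for i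
  proof -
    have "real (\<sigma> * nat \<bar>li i\<bar>) = real \<sigma> * \<bar>real (i div K) - real h\<bar>" by (simp add: li_def)
    then have "ln (b i) = real \<sigma> * \<bar>real (i div K) - real h\<bar> * u"
      by (simp only: b_def ln_realpow u_def)
    moreover have "\<bar>l i\<bar> = \<bar>real (i div K) - real h\<bar>" by (simp add: l_def li_def)
    ultimately show ?thesis
      using B0 b0[of i] by (simp add: F_def ln_mult_pos ln_divide_pos ln_realpow algebra_simps)
  qed
  have "0 \<le> ln (fact N * 2 ^ N * exp (- ln 16 * real (N * (N - 1) div 2)) * (\<Prod>i<N. F i))"
    using ge1 unfolding F_def[symmetric] by (rule ln_ge_zero)
  also have "\<dots> = ln (fact N) + N * ln 2 - ln 16 * real (N * (N - 1) div 2) + (\<Sum>i<N. ln (F i))"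
  proof -
    have "ln (\<Prod>i<N. F i) = (\<Sum>i<N. ln (F i))" by (rule ln_prod) (use F0 in \<open>auto simp: less_imp_neq[symmetric]\<close>)
    moreover have "(\<Prod>i<N. F i) > 0" using F0 by (intro prod_pos) auto
    ultimately show ?thesis by (simp add: ln_mult_pos ln_realpow)
  qed
  also have "(\<Sum>i<N. ln (F i)) = N * ln 2 + (L * (\<Sum>k<K. k * ln B - ln (fact k)) + K * (real h * (real h + 1)) * (X + \<sigma> * u))"
  proof -
    have "(\<Sum>i<N. ln (F i)) = N * ln 2 + (\<Sum>i<N. ((i mod K) * ln B - ln (fact (i mod K))) + \<bar>real (i div K) - real h\<bar> * (X + \<sigma> * u))"
      by (simp add: lnF sum.distrib)
    also have "(\<Sum>i<N. ((i mod K) * ln B - ln (fact (i mod K))) + \<bar>real (i div K) - real h\<bar> * (X + \<sigma> * u)) =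
       (\<Sum>l<L. \<Sum>k<K. (k * ln B - ln (fact k)) + \<bar>real l - real h\<bar> * (X + \<sigma> * u))"
      unfolding N_def by (rule sum_mod_div_split[OF K0])
    also have "\<dots> = (\<Sum>l<L. (\<Sum>k<K. k * ln B - ln (fact k)) + K * (\<bar>real l - real h\<bar> * (X + \<sigma> * u)))"
      by (simp only: sum.distrib sum_constant card_lessThan)
    also have "\<dots> = L * (\<Sum>k<K. k * ln B - ln (fact k)) + K * ((\<Sum>l<L. \<bar>real l - real h\<bar>) * (X + \<sigma> * u))"
      by (simp only: sum.distrib sum_constant card_lessThan sum_distrib_left[symmetric] sum_distrib_right[symmetric])
    also have "(\<Sum>l<L. \<bar>real l - real h\<bar>) = real h * (real h + 1)" unfolding L_def by (rule sum_abs_centered)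
    finally show ?thesis by (simp only: mult.assoc)
  qed
  also have "real (N * (N - 1) div 2) = real N * (real N - 1) / 2"
  proof -
    have "even (N * (N - 1))" by (cases "even N") auto
    then have "real (N * (N - 1) div 2) = real (N * (N - 1)) / 2" by (simp only: real_of_nat_div of_nat_numeral)
    then show ?thesis using N0 by (simp add: of_nat_diff)
  qed
  finally have "ln 16 * (real N * (real N - 1) / 2) \<le> ln (fact N) + N * (2 * ln 2) + L * (\<Sum>k<K. k * ln B - ln (fact k)) +
     K * (real h * (real h + 1)) * (X + \<sigma> * u)" by (simp add: algebra_simps)
  moreover have "2 * ln 2 = ln (4::real)"
  proof -
    have "ln (2 ^ 2) = real 2 * ln (2::real)" by (rule ln_realpow)
    then show ?thesis by simp
  qed
  moreover have "real \<sigma> = 4 * real L - 1" by (simp add: \<sigma>_def L_def)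
  moreover have "ln (fact N) + N * ln 4 + L * (\<Sum>k<K. k * ln B - ln (fact k)) +
     K * (real h * (real h + 1)) * (X + (4 * real L - 1) * u) < ln 16 * (real N * (real N - 1) / 2)"
    using parameter_inequality[OF L_def h m K_def N_def _ _ _ _ B_def X_def, of u] lo hi mu(2) p(2)
    unfolding L_def[symmetric] by simp
  ultimately show False by simp
qed

section \<open>The equation\<close>

lemma odd_square_mod_8: "a ^ 2 mod 8 = 1" if "odd a" for a :: int
proof -
  have "a mod 8 = 1 \<or> a mod 8 = 3 \<or> a mod 8 = 5 \<or> a mod 8 = 7" using that by presburger
  then have "(a mod 8) ^ 2 mod 8 = 1" by auto
  then show ?thesis by (simp add: power_mod)
qed

text \<open>If \<open>x\<close> were even, \<open>y\<close> would be even and 4 would divide 2.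
  Hence both are odd, their squares are 1 modulo 8, and so \<open>y ^ p\<close> is congruent to
  \<open>y\<close> and \<open>x ^ 2 - 2\<close> to -1.\<close>

lemma lebesgue_nagell_mod_8:
  fixes x y :: int
  assumes "x ^ 2 - 2 = y ^ p" "odd p" "p \<ge> 2"
  shows "y mod 8 = 7"
proof -
  have "odd x"
  proof
    assume "even x"
    then have "2 ^ 2 dvd x ^ 2" by (rule dvd_power_same)
    moreover have "even (y ^ p)" using \<open>even x\<close> by (simp add: assms(1)[symmetric])
    then have "even y" by simp
    then have "2 ^ p dvd y ^ p" by (rule dvd_power_same)
    then have "2 ^ 2 dvd y ^ p" using le_imp_power_dvd[OF assms(3), of "2::int"] by (rule dvd_trans[rotated])
    ultimately have "2 ^ 2 dvd x ^ 2 - y ^ p" by (rule dvd_diff)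
    moreover have "x ^ 2 - y ^ p = 2" using assms(1) by simp
    ultimately show False by simp
  qed
  have "odd (x ^ 2 - 2)" using \<open>odd x\<close> by simp
  then have "odd y" using assms(1,3) by (simp add: assms(1))
  obtain k where k: "p = 2 * k + 1" using assms(2) by (rule oddE)
  have "y ^ p mod 8 = (y * (y ^ 2) ^ k) mod 8" by (simp add: k power_mult)
  also have "\<dots> = (y * ((y ^ 2 mod 8) ^ k mod 8)) mod 8" by (simp add: power_mod mod_mult_right_eq)
  also have "\<dots> = y mod 8" using odd_square_mod_8[OF \<open>odd y\<close>] by simp
  finally have "y mod 8 = (x ^ 2 - 2) mod 8" by (simp add: assms(1))
  then show ?thesis using odd_square_mod_8[OF \<open>odd x\<close>] by presburger
qed

text \<open>The descent supplies the linear form for \<open>no_small_linear_form\<close>. The case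
  \<open>r = 0\<close>, in which the node positions would not separate the nodes, is excluded
  directly.\<close>

lemma lebesgue_nagell_no_large_solution:
  fixes x y :: int
  assumes p: "prime p" "p > 911" and eq: "x ^ 2 - 2 = y ^ p" and y: "y \<ge> 7" and x0: "x \<ge> 0"
  shows False
proof -
  have oddp: "odd p" using p by (intro prime_odd_nat) auto
  have "y mod 8 = 7" using lebesgue_nagell_mod_8[OF eq oddp] p by simp
  then have "odd y" by presburger
  from lebesgue_nagell_descent[OF eq this oddp] obtain \<alpha> r where
    r: "2 * \<bar>r\<bar> < int p" and xe: "x + sqrt 2 = eps powi r * emb \<alpha> ^ p" and n: "\<bar>nrm \<alpha>\<bar> = \<bar>y\<bar>" by blast
  have n': "\<bar>nrm \<alpha>\<bar> = y" using n y by simp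
  have \<alpha>0: "\<alpha> \<noteq> 0" using n' y by auto
  define X where "X = real_of_int x"
  define Y where "Y = real_of_int y"
  have Y: "Y \<ge> 7" using y by (simp add: Y_def)
  have XY: "X ^ 2 - 2 = Y ^ p"
    unfolding X_def Y_def using arg_cong[OF eq, of real_of_int] by simp
  have "Y ^ 2 \<le> Y ^ p" using Y p by (intro power_increasing) auto
  then have "Y ^ 2 \<le> X ^ 2" using XY by linarith
  then have YX: "Y \<le> X" using x0 by (intro power2_le_imp_le[of Y X]) (auto simp: X_def)
  have s2: "sqrt 2 < 142/100" by (rule real_less_lsqrt) (simp_all add: power2_eq_square)
  define \<Lambda> where "\<Lambda> = ln ((X + sqrt 2) / (X - sqrt 2))"
  have Xm: "X - sqrt 2 > 0" and Xp: "X + sqrt 2 > 0" using YX Y s2 by (auto intro: add_pos_pos)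
  have "1 < (X + sqrt 2) / (X - sqrt 2)" using Xm by (subst less_divide_eq_1_pos) auto
  then have \<Lambda>0: "\<Lambda> > 0" unfolding \<Lambda>_def by (rule ln_gt_zero)
  have \<Lambda>X: "\<Lambda> * X \<le> 4"
  proof -
    have "\<Lambda> \<le> (X + sqrt 2) / (X - sqrt 2) - 1" unfolding \<Lambda>_def using Xm Xp by (intro ln_le_minus_one) auto
    also have "\<dots> = 2 * sqrt 2 / (X - sqrt 2)" using Xm by (simp add: field_simps)
    finally have "\<Lambda> * X \<le> 2 * sqrt 2 / (X - sqrt 2) * X" using YX Y by (intro mult_right_mono) auto
    also have "\<dots> = (2 * sqrt 2 * X) / (X - sqrt 2)" by simp
    also have "\<dots> \<le> 4"
    proof -
      define w where "w = sqrt 2 * X"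
      have "w \<le> 142/100 * X" unfolding w_def using YX Y s2 by (intro mult_right_mono) auto
      then have "2 * w \<le> 4 * X - 4 * sqrt 2" using YX Y s2 by linarith
      then have "2 * sqrt 2 * X \<le> 4 * (X - sqrt 2)" by (simp add: w_def)
      then show ?thesis using Xm by (simp add: pos_divide_le_eq)
    qed
    finally show ?thesis .
  qed
  have \<Lambda>eq: "\<Lambda> = of_int r * (2 * ln eps) + of_int (int p) * ln (emb \<alpha> ^ 2 / Y)"
  proof -
    have e0: "eps > 0" using eps_gt_1 by simp
    have a0: "emb \<alpha> ^ 2 > 0" using \<alpha>0 by simp
    \<comment> \<open>\<open>\<Lambda>\<close> is also the logarithm of
      \<open>(X + sqrt 2) ^ 2 / Y ^ p\<close>, because
      \<open>(X + sqrt 2) * (X - sqrt 2) = Y ^ p\<close>.\<close>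
    have "(X + sqrt 2) ^ 2 = (eps powi r) ^ 2 * (emb \<alpha> ^ 2) ^ p"
      unfolding X_def xe by (simp add: power_mult_distrib power_mult[symmetric] mult.commute)
    then have "ln ((X + sqrt 2) ^ 2) = ln ((eps powi r) ^ 2) + ln ((emb \<alpha> ^ 2) ^ p)"
      using e0 a0 by (simp add: ln_mult_pos)
    moreover have "ln (eps powi r) = of_int r * ln eps"
    proof -
      have "eps powi r = eps powr (of_int r)" using e0 by (simp add: powr_real_of_int')
      then show ?thesis using e0 by (simp add: ln_powr)
    qed
    ultimately have 1: "2 * ln (X + sqrt 2) = of_int r * (2 * ln eps) + p * ln (emb \<alpha> ^ 2)"
      by (simp only: ln_realpow)
    have "(X + sqrt 2) * (X - sqrt 2) = Y ^ p" using XY by (simp add: power2_eq_square algebra_simps)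
    then have "ln ((X + sqrt 2) * (X - sqrt 2)) = p * ln Y" by (simp only: ln_realpow)
    then have 2: "ln (X + sqrt 2) + ln (X - sqrt 2) = p * ln Y" using Xm Xp by (simp add: ln_mult_pos)
    have "\<Lambda> = ln (X + sqrt 2) - ln (X - sqrt 2)" unfolding \<Lambda>_def using Xm Xp by (simp add: ln_divide_pos)
    moreover have "ln (emb \<alpha> ^ 2 / Y) = ln (emb \<alpha> ^ 2) - ln Y" using a0 Y by (intro ln_divide_pos) auto
    ultimately show ?thesis using 1 2 by (simp add: right_diff_distrib)
  qed
  \<comment> \<open>For \<open>r = 0\<close> the form is \<open>p * g\<close> with \<open>g\<close>
    tiny, so \<open>\<alpha> ^ 2\<close> and its conjugate nearly agree. They differ by a positive
    integer multiple of \<open>4 * sqrt 2\<close>, which forces \<open>Y * g \<ge> 1\<close> and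
    then \<open>p \<le> \<Lambda> * X \<le> 4\<close>.\<close>
  have "r \<noteq> 0"
  proof
    assume "r = 0"
    define g where "g = ln (emb \<alpha> ^ 2 / Y)"
    have pg: "real p * g = \<Lambda>" using \<Lambda>eq \<open>r = 0\<close> by (simp add: g_def)
    then have "real p * g > 0" using \<Lambda>0 by simp
    then have g0: "g > 0" by (simp add: zero_less_mult_iff)
    have "emb \<alpha> ^ 2 / Y > 0" using \<alpha>0 Y by simp
    then have e1: "emb \<alpha> ^ 2 = Y * exp g" using Y by (simp add: g_def)
    have "(emb \<alpha> * emb (conj2 \<alpha>)) ^ 2 = Y ^ 2"
    proof -
      have "nrm \<alpha> ^ 2 = y ^ 2" unfolding n'[symmetric] by simp
      then show ?thesis unfolding emb_mult_conj2 Y_def by (simp only: of_int_power[symmetric])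
    qed
    then have "emb \<alpha> ^ 2 * emb (conj2 \<alpha>) ^ 2 = Y * Y"
      by (simp only: power_mult_distrib power2_eq_square[of Y])
    then have "Y * (exp g * emb (conj2 \<alpha>) ^ 2) = Y * Y" by (simp only: e1 mult.assoc)
    then have "exp g * emb (conj2 \<alpha>) ^ 2 = Y" using Y by simp
    then have e2: "emb (conj2 \<alpha>) ^ 2 = Y * exp (- g)" by (simp add: exp_minus field_simps)
    define ab where "ab = rat \<alpha> * irr \<alpha>"
    have "emb \<alpha> ^ 2 - emb (conj2 \<alpha>) ^ 2 = 4 * sqrt 2 * of_int ab"
      by (simp add: emb_def conj2_def ab_def power2_eq_square algebra_simps)
    then have d: "Y * (exp g - exp (- g)) = 4 * sqrt 2 * of_int ab" unfolding e1 e2 by (simp add: algebra_simps)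
    have "Y * (exp g - exp (- g)) > 0" using Y g0 by simp
    then have "real_of_int ab > 0" unfolding d by (simp add: zero_less_mult_iff)
    then have "1 \<le> real_of_int ab" by simp
    then have "4 * 1 * 1 \<le> 4 * sqrt 2 * real_of_int ab" by (intro mult_mono) auto
    then have "4 \<le> Y * (exp g - exp (- g))" unfolding d by simp
    also have "\<dots> \<le> Y * (4 * g)"
    proof (rule mult_left_mono)
      have "g * 1 \<le> g * real p" using g0 p by (intro mult_left_mono) auto
      then have "g \<le> \<Lambda>" using pg by (simp add: mult.commute)
      moreover have "\<Lambda> * 7 \<le> \<Lambda> * X" using \<Lambda>0 YX Y by (intro mult_left_mono) auto
      ultimately have "g \<le> 1" using \<Lambda>X by linarith
      then show "exp g - exp (- g) \<le> 4 * g"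
        using abs_exp_minus_1_le[of g] abs_exp_minus_1_le[of "- g"] g0 by linarith
    qed (use Y in simp)
    finally have "1 \<le> Y * g" by simp
    then have "real p * 1 \<le> real p * (Y * g)" by (intro mult_left_mono) auto
    also have "\<dots> = \<Lambda> * Y" using pg by (simp add: mult_ac)
    also have "\<dots> \<le> \<Lambda> * X" using \<Lambda>0 YX by (intro mult_left_mono) auto
    finally show False using \<Lambda>X p by linarith
  qed
  moreover have "\<bar>\<Lambda>\<bar> * exp (p * ln Y / 2) \<le> 4"
  proof -
    have "exp (p * ln Y / 2) ^ 2 = Y ^ p"
    proof -
      have "exp (p * ln Y / 2) ^ 2 = exp (p * ln Y)" by (simp add: exp_double[symmetric])
      also have "\<dots> = Y ^ p" using Y by (simp add: exp_of_nat_mult)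
      finally show ?thesis .
    qed
    then have "exp (p * ln Y / 2) ^ 2 \<le> X ^ 2" using XY by linarith
    then have "exp (p * ln Y / 2) \<le> X" using YX Y by (intro power2_le_imp_le[of "exp (p * ln Y / 2)" X]) auto
    then have "\<Lambda> * exp (p * ln Y / 2) \<le> \<Lambda> * X" using \<Lambda>0 by (intro mult_left_mono) auto
    then have "\<Lambda> * exp (p * ln Y / 2) \<le> 4" using \<Lambda>X by (rule order_trans)
    then show ?thesis using \<Lambda>0 by simp
  qed
  ultimately show False
    using no_small_linear_form[OF p(1) _ y n' _ r, of \<Lambda>] \<Lambda>eq p(2) by (simp add: Y_def)
qed

theorem theorem1p4:
  fixes p :: nat and x y :: int
  assumes "prime p" and "p > 911" and "x^2 - 2 = y^p"
  shows "y = -1"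
proof (rule ccontr)
  assume ne: "y \<noteq> -1"
  have oddp: "odd p" using assms by (intro prime_odd_nat) auto
  have m8: "y mod 8 = 7" using lebesgue_nagell_mod_8[OF assms(3) oddp] assms(2) by simp
  have "y \<ge> 0"
  proof (rule ccontr)
    assume "\<not> y \<ge> 0"
    \<comment> \<open>A negative number congruent to 7 modulo 8 other than -1 is at most -9, whereas
      \<open>y ^ p = x ^ 2 - 2 \<ge> -2\<close>.\<close>
    then have y9: "- y \<ge> 9" using m8 ne by presburger
    have "- y = (- y) ^ 1" by simp
    also have "\<dots> \<le> (- y) ^ p" using y9 assms(2) by (intro power_increasing) auto
    also have "\<dots> = - (y ^ p)" using oddp by simp
    also have "\<dots> = 2 - x ^ 2" using assms(3) by linarith
    also have "\<dots> \<le> 2" by simp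
    finally show False using y9 by linarith
  qed
  then have "y \<ge> 7" using m8 by presburger
  moreover have "\<bar>x\<bar> ^ 2 - 2 = y ^ p" using assms(3) by simp
  ultimately show False using lebesgue_nagell_no_large_solution[OF assms(1,2), of "\<bar>x\<bar>" y] by simp
qed

end
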